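(* Let $M\subset\bigoplus_{i=1}^rA[-\delta_i]$ be a graded right $A$-submodule and $M'=L(M)\subset\bigoplus_iS[-\delta_i]$. Let $\{g_j\}$ be a set of homogeneous elements of $M$ and $g'_j=\iota(g_j)$. Then $\{g_j\}$ is a basis (resp. minimal basis) of $M$ if and only if $\{g'_j\}$ is a basis (resp. minimal basis) of $M'$. In particular $b_d(M)=b_d(M')$ for all $d\ge0$.
   Context: Let $\mathbb K$ be a field, $F=\mathbb K\langle x_1,\dots,x_n\rangle$ with standard grading, $I\subset F$ a graded two-sided ideal, $A=F/I$, $A[-\delta]_d=A_{d-\delta}$, $\bigoplus_{i=1}^rA[-\delta_i]$ the graded free right $A$-module with basis $e_i$ of degree $\delta_i$. A basis of a graded module is a homogeneous generating set; minimal if no element lies in the submodule generated by the others; $b_d$ counts the degree-$d$ elements of a minimal homogeneous basis. Let $P=\mathbb K[x_{ij}\mid1\le i\le n,j\ge1]$ (commutative, $\deg x_{ij}=1$), $Q$ the ideal generated by all $x_{ij}x_{kj}$, $R=P/Q$, $\sigma:x_{ij}\mapsto x_{i,j+1}$, $\iota:F\to R$ the $\mathbb K$-linear map $x_{i_1}\cdots x_{i_d}\mapsto x_{i_11}\cdots x_{i_dd}$, $J$ the ideal generated by $\bigcup_{k\ge0}\sigma^k(\iota(I))$, $S=R/J$ (with induced $\sigma$ and induced injective graded linear $\iota:A\to S$). $\bigoplus_iS[-\delta_i]$ is the graded free $S$-module with basis $e'_i$ of degree $\delta_i$; $\iota:\bigoplus_iA[-\delta_i]\to\bigoplus_iS[-\delta_i]$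 is $e_if\mapsto e'_i\sigma^{\delta_i}(\iota(f))$; $L(M)$ is the $S$-submodule generated by $\iota(M)$. *)

theory Defs
  imports "HOL-Algebra.QuotRing" "HOL-Library.Poly_Mapping"
begin

text \<open>Noncommutative polynomials: finitely supported maps from words (lists of
  letter indices) to the field.  The letter i stands for x_i, 1 <= i <= n.\<close>
type_synonym 'k ncpoly = "nat list \<Rightarrow>\<^sub>0 'k"

definition nc_mult :: "'k::field ncpoly \<Rightarrow> 'k ncpoly \<Rightarrow> 'k ncpoly" where
  "nc_mult f g = (\<Sum>u\<in>Poly_Mapping.keys f. \<Sum>v\<in>Poly_Mapping.keys g.
                    Poly_Mapping.single (u @ v) (Poly_Mapping.lookup f u * Poly_Mapping.lookup g v))"

definition Fring :: "nat \<Rightarrow> ('k::field ncpoly) ring" where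
  "Fring n = \<lparr>carrier = {f. \<forall>w\<in>Poly_Mapping.keys f. set w \<subseteq> {1..n}},
              mult = nc_mult, one = Poly_Mapping.single [] 1, zero = 0, add = (+)\<rparr>"

definition homF :: "nat \<Rightarrow> 'k::field ncpoly \<Rightarrow> bool" where
  "homF d f \<longleftrightarrow> (\<forall>w\<in>Poly_Mapping.keys f. length w = d)"

definition graded_ideal_F :: "nat \<Rightarrow> 'k::field ncpoly set \<Rightarrow> bool" where
  "graded_ideal_F n I \<longleftrightarrow> ideal I (Fring n) \<and>
      I = genideal (Fring n) {f \<in> I. \<exists>d. homF d f}"

definition Aring :: "nat \<Rightarrow> 'k::field ncpoly set \<Rightarrow> ('k ncpoly set) ring" where
  "Aring n I = Fring n Quot I"

definition homA :: "nat \<Rightarrow> 'k::field ncpoly set \<Rightarrow> nat \<Rightarrow> 'k ncpoly set \<Rightarrow> bool" where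
  "homA n I d a \<longleftrightarrow> (\<exists>f\<in>carrier (Fring n). homF d f \<and> a = I +>\<^bsub>Fring n\<^esub> f)"

text \<open>Commutative polynomials in variables x_(i,j): monomials are finitely supported
  exponent vectors on index pairs (i,j).\<close>
type_synonym 'k cpoly = "((nat \<times> nat) \<Rightarrow>\<^sub>0 nat) \<Rightarrow>\<^sub>0 'k"

definition Pring :: "nat \<Rightarrow> ('k::field cpoly) ring" where
  "Pring n = \<lparr>carrier = {p. \<forall>m\<in>Poly_Mapping.keys p. \<forall>v\<in>Poly_Mapping.keys m. fst v \<in> {1..n} \<and> snd v \<ge> 1},
              mult = (*), one = 1, zero = 0, add = (+)\<rparr>"

definition homP :: "nat \<Rightarrow> 'k::field cpoly \<Rightarrow> bool" where
  "homP d p \<longleftrightarrow> (\<forall>m\<in>Poly_Mapping.keys p. (\<Sum>v\<in>Poly_Mapping.keys m. Poly_Mapping.lookup m v) = d)"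

definition Qideal :: "nat \<Rightarrow> 'k::field cpoly set" where
  "Qideal n = genideal (Pring n)
     {Poly_Mapping.single (Poly_Mapping.single (i, j) 1 + Poly_Mapping.single (k, j) 1) 1
       | i k j. i \<in> {1..n} \<and> k \<in> {1..n} \<and> j \<ge> 1}"

definition Rring :: "nat \<Rightarrow> ('k::field cpoly set) ring" where
  "Rring n = Pring n Quot Qideal n"

definition piQ :: "nat \<Rightarrow> 'k::field cpoly \<Rightarrow> 'k cpoly set" where
  "piQ n p = Qideal n +>\<^bsub>Pring n\<^esub> p"

definition sigma_mon :: "((nat \<times> nat) \<Rightarrow>\<^sub>0 nat) \<Rightarrow> ((nat \<times> nat) \<Rightarrow>\<^sub>0 nat)" where
  "sigma_mon m = (\<Sum>v\<in>Poly_Mapping.keys m. Poly_Mapping.single (fst v, snd v + 1) (Poly_Mapping.lookup m v))"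

definition sigmaP :: "'k::field cpoly \<Rightarrow> 'k cpoly" where
  "sigmaP p = (\<Sum>m\<in>Poly_Mapping.keys p. Poly_Mapping.single (sigma_mon m) (Poly_Mapping.lookup p m))"

definition mon_of_word :: "nat list \<Rightarrow> ((nat \<times> nat) \<Rightarrow>\<^sub>0 nat)" where
  "mon_of_word w = (\<Sum>k<length w. Poly_Mapping.single (w ! k, k + 1) 1)"

definition iotaP :: "'k::field ncpoly \<Rightarrow> 'k cpoly" where
  "iotaP f = (\<Sum>w\<in>Poly_Mapping.keys f. Poly_Mapping.single (mon_of_word w) (Poly_Mapping.lookup f w))"

text \<open>sigma on R (well defined since Q is sigma-stable).\<close>
definition sigmaR :: "nat \<Rightarrow> 'k::field cpoly set \<Rightarrow> 'k cpoly set" where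
  "sigmaR n x = piQ n (sigmaP (SOME p. p \<in> x))"

definition Jideal :: "nat \<Rightarrow> 'k::field ncpoly set \<Rightarrow> 'k cpoly set set" where
  "Jideal n I = genideal (Rring n) {(sigmaR n ^^ k) (piQ n (iotaP f)) | k f. f \<in> I}"

definition Sring :: "nat \<Rightarrow> 'k::field ncpoly set \<Rightarrow> ('k cpoly set set) ring" where
  "Sring n I = Rring n Quot Jideal n I"

definition piS :: "nat \<Rightarrow> 'k::field ncpoly set \<Rightarrow> 'k cpoly set \<Rightarrow> 'k cpoly set set" where
  "piS n I x = Jideal n I +>\<^bsub>Rring n\<^esub> x"

definition homS :: "nat \<Rightarrow> 'k::field ncpoly set \<Rightarrow> nat \<Rightarrow> 'k cpoly set set \<Rightarrow> bool" where
  "homS n I d s \<longleftrightarrow> (\<exists>p\<in>carrier (Pring n). homP d p \<and> s = piS n I (piQ n p))"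

definition sigmaS :: "nat \<Rightarrow> 'k::field ncpoly set \<Rightarrow> 'k cpoly set set \<Rightarrow> 'k cpoly set set" where
  "sigmaS n I s = piS n I (sigmaR n (SOME x. x \<in> s))"

definition iotaA :: "nat \<Rightarrow> 'k::field ncpoly set \<Rightarrow> 'k ncpoly set \<Rightarrow> 'k cpoly set set" where
  "iotaA n I a = piS n I (piQ n (iotaP (SOME f. f \<in> a)))"

text \<open>Elements are r-tuples, encoded as functions nat => B that are zero from r on;
  the basis vector e_i (i<r) has degree delta i.  B acts from the right.\<close>
definition fm_carrier :: "('a, 'b) ring_scheme \<Rightarrow> nat \<Rightarrow> (nat \<Rightarrow> 'a) set" where
  "fm_carrier B r = {v. (\<forall>i<r. v i \<in> carrier B) \<and> (\<forall>i\<ge>r. v i = \<zero>\<^bsub>B\<^esub>)}"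

definition fm_zero :: "('a, 'b) ring_scheme \<Rightarrow> nat \<Rightarrow> 'a" where
  "fm_zero B = (\<lambda>i. \<zero>\<^bsub>B\<^esub>)"

definition fm_add :: "('a, 'b) ring_scheme \<Rightarrow> nat \<Rightarrow> (nat \<Rightarrow> 'a) \<Rightarrow> (nat \<Rightarrow> 'a) \<Rightarrow> nat \<Rightarrow> 'a" where
  "fm_add B r v w = (\<lambda>i. if i < r then v i \<oplus>\<^bsub>B\<^esub> w i else \<zero>\<^bsub>B\<^esub>)"

definition fm_smult :: "('a, 'b) ring_scheme \<Rightarrow> nat \<Rightarrow> (nat \<Rightarrow> 'a) \<Rightarrow> 'a \<Rightarrow> nat \<Rightarrow> 'a" where
  "fm_smult B r v a = (\<lambda>i. if i < r then v i \<otimes>\<^bsub>B\<^esub> a else \<zero>\<^bsub>B\<^esub>)"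

definition is_submodule :: "('a, 'b) ring_scheme \<Rightarrow> nat \<Rightarrow> (nat \<Rightarrow> 'a) set \<Rightarrow> bool" where
  "is_submodule B r N \<longleftrightarrow> N \<subseteq> fm_carrier B r \<and> fm_zero B \<in> N \<and>
     (\<forall>v\<in>N. \<forall>w\<in>N. fm_add B r v w \<in> N) \<and>
     (\<forall>v\<in>N. \<forall>a\<in>carrier B. fm_smult B r v a \<in> N)"

definition submod_gen :: "('a, 'b) ring_scheme \<Rightarrow> nat \<Rightarrow> (nat \<Rightarrow> 'a) set \<Rightarrow> (nat \<Rightarrow> 'a) set" where
  "submod_gen B r G = \<Inter>{N. is_submodule B r N \<and> G \<subseteq> N}"

definition fm_hom :: "('a, 'b) ring_scheme \<Rightarrow> (nat \<Rightarrow> 'a \<Rightarrow> bool) \<Rightarrow> nat \<Rightarrow> (nat \<Rightarrow> nat)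
                      \<Rightarrow> nat \<Rightarrow> (nat \<Rightarrow> 'a) \<Rightarrow> bool" where
  "fm_hom B H r \<delta> d v \<longleftrightarrow> v \<in> fm_carrier B r \<and>
     (\<forall>i<r. if \<delta> i \<le> d then H (d - \<delta> i) (v i) else v i = \<zero>\<^bsub>B\<^esub>)"

definition is_homogeneous :: "('a, 'b) ring_scheme \<Rightarrow> (nat \<Rightarrow> 'a \<Rightarrow> bool) \<Rightarrow> nat \<Rightarrow> (nat \<Rightarrow> nat)
                      \<Rightarrow> (nat \<Rightarrow> 'a) \<Rightarrow> bool" where
  "is_homogeneous B H r \<delta> v \<longleftrightarrow> (\<exists>d. fm_hom B H r \<delta> d v)"

definition is_graded_submodule :: "('a, 'b) ring_scheme \<Rightarrow> (nat \<Rightarrow> 'a \<Rightarrow> bool) \<Rightarrow> nat \<Rightarrow> (nat \<Rightarrow> nat)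
                      \<Rightarrow> (nat \<Rightarrow> 'a) set \<Rightarrow> bool" where
  "is_graded_submodule B H r \<delta> N \<longleftrightarrow> is_submodule B r N \<and>
     N = submod_gen B r {v \<in> N. is_homogeneous B H r \<delta> v}"

definition is_basis :: "('a, 'b) ring_scheme \<Rightarrow> (nat \<Rightarrow> 'a \<Rightarrow> bool) \<Rightarrow> nat \<Rightarrow> (nat \<Rightarrow> nat)
                      \<Rightarrow> (nat \<Rightarrow> 'a) set \<Rightarrow> (nat \<Rightarrow> 'a) set \<Rightarrow> bool" where
  "is_basis B H r \<delta> N G \<longleftrightarrow> (\<forall>g\<in>G. is_homogeneous B H r \<delta> g) \<and> submod_gen B r G = N"

definition is_min_basis :: "('a, 'b) ring_scheme \<Rightarrow> (nat \<Rightarrow> 'a \<Rightarrow> bool) \<Rightarrow> nat \<Rightarrow> (nat \<Rightarrow> nat)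
                      \<Rightarrow> (nat \<Rightarrow> 'a) set \<Rightarrow> (nat \<Rightarrow> 'a) set \<Rightarrow> bool" where
  "is_min_basis B H r \<delta> N G \<longleftrightarrow> is_basis B H r \<delta> N G \<and>
     (\<forall>g\<in>G. g \<notin> submod_gen B r (G - {g}))"

definition bnum :: "('a, 'b) ring_scheme \<Rightarrow> (nat \<Rightarrow> 'a \<Rightarrow> bool) \<Rightarrow> nat \<Rightarrow> (nat \<Rightarrow> nat)
                      \<Rightarrow> (nat \<Rightarrow> 'a) set \<Rightarrow> nat \<Rightarrow> nat" where
  "bnum B H r \<delta> N d = card {g \<in> (SOME G. is_min_basis B H r \<delta> N G). fm_hom B H r \<delta> d g}"

definition iota_mod :: "nat \<Rightarrow> 'k::field ncpoly set \<Rightarrow> nat \<Rightarrow> (nat \<Rightarrow> nat)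
                        \<Rightarrow> (nat \<Rightarrow> 'k ncpoly set) \<Rightarrow> nat \<Rightarrow> 'k cpoly set set" where
  "iota_mod n I r \<delta> v = (\<lambda>i. if i < r then (sigmaS n I ^^ \<delta> i) (iotaA n I (v i))
                              else \<zero>\<^bsub>Sring n I\<^esub>)"

definition Lmod :: "nat \<Rightarrow> 'k::field ncpoly set \<Rightarrow> nat \<Rightarrow> (nat \<Rightarrow> nat)
                    \<Rightarrow> (nat \<Rightarrow> 'k ncpoly set) set \<Rightarrow> (nat \<Rightarrow> 'k cpoly set set) set" where
  "Lmod n I r \<delta> M = submod_gen (Sring n I) r (iota_mod n I r \<delta> ` M)"

end

theory Submission
  imports Defs
begin

text \<open>The embedding \<open>\<iota>\<^sub>k = \<sigma>\<^sup>k \<circ> \<iota>\<close> has a linear retraction \<open>\<rho>\<^sub>k\<close>, which reads off the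
  coefficients of the monomials \<open>x\<^bsub>i\<^sub>1,k+1\<^esub> \<dots> x\<^bsub>i\<^sub>d,k+d\<^esub>\<close> and forgets all others. Since the places of a
  word are consecutive, \<open>\<rho>\<^sub>k\<close> maps the ideal generated by \<open>Q\<close> and all \<open>\<iota>\<^sub>j(I)\<close> into \<open>I\<close>, and
  \<open>\<rho>\<^sub>k (\<iota>\<^sub>k(f) p) = f \<rho>\<^bsub>k+e\<^esub>(p)\<close> for \<open>f\<close> homogeneous of degree \<open>e\<close>. Hence on the free modules
  \<open>\<rho> (\<iota>(g) s) = g \<rho>\<^sub>d(s)\<close> for \<open>g\<close> homogeneous of degree \<open>d\<close>, so \<open>\<rho>\<close> maps \<open>L(N)\<close> back into \<open>N\<close>, and
  \<open>\<iota>(v) \<in> L(N)\<close> holds only for \<open>v \<in> N\<close>. This transfers generation and minimality in both directions.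
  The numbers \<open>b\<^sub>d\<close> do not depend on the minimal basis because its degree \<open>d\<close> part is a basis of a
  pregeometry on the degree \<open>d\<close> part of the module.\<close>

section \<open>Pregeometries\<close>

text \<open>The obstacle is commutativity of \<open>S\<close>: a product may put letters in front of
  \<open>\<iota>(g)\<close>, leave gaps between places or use a place twice, so membership in
  \<open>L(N)\<close> says nothing by itself about right multiples over \<open>A\<close>. The
  retraction discards such products, but the price is linearity, because the index of
  \<open>\<rho>\<close> moves with the degree of the left factor. Therefore every argument about
  submodules passes through homogeneous generators and arbitrary multiples of them. Since
  \<open>bnum\<close> chooses its minimal basis, two more facts are required. Existence of a minimal
  basis is needed over \<open>A\<close> only, as \<open>S\<close> inherits one by transport.
  Independence of the choice is needed over \<open>S\<close>, where the degree parts may have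
  infinite dimension; this is why the counting is done in a pregeometry and not by dimensions. Its
  exchange law comes from the fact that elements of degree 0 are images of scalars, so the nonzero
  ones are invertible.\<close>

locale pregeometry =
  fixes E :: "'a set" and cl :: "'a set \<Rightarrow> 'a set"
  assumes cl_sub: "X \<subseteq> E \<Longrightarrow> cl X \<subseteq> E"
    and cl_ext: "X \<subseteq> E \<Longrightarrow> X \<subseteq> cl X"
    and cl_mono: "X \<subseteq> Y \<Longrightarrow> Y \<subseteq> E \<Longrightarrow> cl X \<subseteq> cl Y"
    and cl_idem: "X \<subseteq> E \<Longrightarrow> cl (cl X) \<subseteq> cl X"
    and cl_exch: "X \<subseteq> E \<Longrightarrow> a \<in> E \<Longrightarrow> b \<in> cl (insert a X) \<Longrightarrow> b \<notin> cl X \<Longrightarrow> a \<in> cl (insert b X)"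
    and cl_fin: "X \<subseteq> E \<Longrightarrow> a \<in> cl X \<Longrightarrow> \<exists>Y\<subseteq>X. finite Y \<and> a \<in> cl Y"
begin

definition indep :: "'a set \<Rightarrow> bool" where
  "indep X \<longleftrightarrow> X \<subseteq> E \<and> (\<forall>x\<in>X. x \<notin> cl (X - {x}))"

definition basis :: "'a set \<Rightarrow> bool" where
  "basis X \<longleftrightarrow> indep X \<and> E \<subseteq> cl X"

lemma cl_trans: "Y \<subseteq> E \<Longrightarrow> X \<subseteq> cl Y \<Longrightarrow> cl X \<subseteq> cl Y"
  using cl_mono[of X "cl Y"] cl_sub[of Y] cl_idem[of Y] by blast

lemma indep_subset:
  assumes "indep X" "Y \<subseteq> X"
  shows "indep Y"
  unfolding indep_def
proof (intro conjI ballI)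
  show "Y \<subseteq> E" using assms by (auto simp: indep_def)
  fix y assume "y \<in> Y"
  moreover have "cl (Y - {y}) \<subseteq> cl (X - {y})"
    using assms by (intro cl_mono) (auto simp: indep_def)
  ultimately show "y \<notin> cl (Y - {y})" using assms by (auto simp: indep_def)
qed

text \<open>If some \<open>z\<close> of \<open>Z\<close> became dependent after adjoining
  \<open>x\<close>, exchange would put \<open>x\<close> into the closure of
  \<open>insert z (Z - {z})\<close>, which is \<open>Z\<close>.\<close>

lemma indep_insert:
  assumes Z: "indep Z" and x: "x \<in> E" "x \<notin> cl Z"
  shows "indep (insert x Z)"
  unfolding indep_def
proof (intro conjI ballI)
  have ZE: "Z \<subseteq> E" using Z by (simp add: indep_def)
  then show "insert x Z \<subseteq> E" using x by simp
  have xZ: "x \<notin> Z" using x cl_ext[OF ZE] by auto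
  fix z assume z: "z \<in> insert x Z"
  show "z \<notin> cl (insert x Z - {z})"
  proof (cases "z = x")
    case True then show ?thesis using x xZ by simp
  next
    case False
    then have zZ: "z \<in> Z" using z by simp
    have eq: "insert x Z - {z} = insert x (Z - {z})" using False by auto
    show ?thesis
    proof
      assume "z \<in> cl (insert x Z - {z})"
      then have "x \<in> cl (insert z (Z - {z}))"
        using cl_exch[of "Z - {z}" x z] ZE x zZ Z eq by (auto simp: indep_def)
      then show False using x zZ by (simp add: insert_absorb)
    qed
  qed
qed

text \<open>Steinitz exchange: an element of \<open>Y\<close> outside \<open>X\<close> is traded for
  one of \<open>X\<close>, which keeps independence and cardinality and lowers the number of
  elements outside \<open>X\<close>.\<close>

lemma card_indep_le:
  assumes X: "finite X" "X \<subseteq> E" "E \<subseteq> cl X"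
  shows "indep Y \<Longrightarrow> finite Y \<Longrightarrow> card Y \<le> card X"
proof (induction "card (Y - X)" arbitrary: Y)
  case 0
  then show ?case using X(1) by (auto intro: card_mono)
next
  case (Suc k)
  then have "Y - X \<noteq> {}" by (metis card.empty nat.distinct(1))
  then obtain y where y: "y \<in> Y" "y \<notin> X" by auto
  have YE: "Y \<subseteq> E" using Suc by (simp add: indep_def)
  \<comment> \<open>Otherwise \<open>Y - {y}\<close> would span, and its closure would contain
    \<open>y\<close>.\<close>
  have "\<not> X \<subseteq> cl (Y - {y})"
  proof
    assume "X \<subseteq> cl (Y - {y})"
    then have "cl X \<subseteq> cl (Y - {y})" using YE by (intro cl_trans) auto
    then show False using X y YE Suc.prems unfolding indep_def by blast
  qed
  then obtain x where x: "x \<in> X" "x \<notin> cl (Y - {y})" by auto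
  define Y' where "Y' = insert x (Y - {y})"
  have xY: "x \<notin> Y - {y}" using x cl_ext[of "Y - {y}"] YE by blast
  have ind: "indep Y'" unfolding Y'_def
    using x X indep_subset[OF Suc.prems(1), of "Y - {y}"] by (intro indep_insert) auto
  have cY: "card Y' = card Y" unfolding Y'_def
    using xY Suc.prems y by (metis card.insert card.remove finite_Diff)
  have "Y' - X = (Y - X) - {y}" unfolding Y'_def using x by auto
  then have "card (Y' - X) = k" using Suc.hyps(2) y Suc.prems(2) by simp
  then have "card Y' \<le> card X" using Suc.hyps(1)[of Y'] ind Suc.prems(2) by (simp add: Y'_def)
  then show ?case using cY by simp
qed

lemma finite_indep:
  assumes X: "finite X" "X \<subseteq> E" "E \<subseteq> cl X" and Y: "indep Y"
  shows "finite Y"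
proof (rule ccontr)
  assume "infinite Y"
  then obtain Z where Z: "Z \<subseteq> Y" "finite Z" "card Z = Suc (card X)"
    using infinite_arbitrarily_large by blast
  then show False using card_indep_le[OF X indep_subset[OF Y Z(1)]] by simp
qed

text \<open>One finite basis forces the other to be finite. If both are infinite,
  \<open>card\<close> is 0 on both sides, which agrees with the convention in
  \<open>bnum\<close>.\<close>

theorem basis_card_eq:
  assumes "basis X" "basis Y"
  shows "card X = card Y"
proof (cases "finite X \<or> finite Y")
  case True
  then have "finite X" "finite Y"
    using assms finite_indep by (auto simp: basis_def indep_def)
  then show ?thesis using assms card_indep_le[of X Y] card_indep_le[of Y X]
    by (auto simp: basis_def indep_def)
next
  case False then show ?thesis by simp
qed

text \<open>Well-order the ground set and keep the elements outside the closure of their predecessors.\<close>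
theorem basis_exists: "\<exists>X. basis X"
proof -
  obtain r where r: "well_order_on (UNIV :: 'a set) r" using well_order_on by blast
  define lt where "lt a b \<longleftrightarrow> (a, b) \<in> r \<and> a \<noteq> b" for a b
  have wf: "wfp lt"
    using r unfolding well_order_on_def lt_def wfp_def
    by (auto simp: set_diff_eq elim!: wf_subset)
  have tot: "lt a b \<or> a = b \<or> lt b a" for a b
    using r unfolding well_order_on_def linear_order_on_def total_on_def lt_def by auto
  have tr: "lt a b \<Longrightarrow> lt b c \<Longrightarrow> lt a c" for a b c
    using r unfolding well_order_on_def linear_order_on_def partial_order_on_def preorder_on_def lt_def
    by (metis transD antisymD)
  define X where "X = {x \<in> E. x \<notin> cl {y \<in> E. lt y x}}"
  have XE: "X \<subseteq> E" by (auto simp: X_def)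
  have "e \<in> E \<Longrightarrow> e \<in> cl X" for e
  proof (induction e rule: wfp_induct_rule[OF wf])
    case (1 e)
    show ?case
    proof (cases "e \<in> X")
      case True then show ?thesis using cl_ext[OF XE] by auto
    next
      case False
      then have "e \<in> cl {y \<in> E. lt y e}" using 1 by (simp add: X_def)
      moreover have "cl {y \<in> E. lt y e} \<subseteq> cl X" using 1 XE by (intro cl_trans) auto
      ultimately show ?thesis by auto
    qed
  qed
  moreover have "indep X" unfolding indep_def
  proof (intro conjI ballI XE notI)
    fix x assume x: "x \<in> X" "x \<in> cl (X - {x})"
    \<comment> \<open>Among the finite sets witnessing that \<open>x\<close> is dependent, one of
      least size is taken: each of its elements is then indispensable, so exchange can be applied to
      the largest one.\<close>
    define Q where "Q Z \<longleftrightarrow> Z \<subseteq> X - {x} \<and> finite Z \<and> x \<in> cl Z" for Z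
    have "\<exists>Z. Q Z" using cl_fin[of "X - {x}" x] XE x unfolding Q_def by blast
    then obtain Z where Z: "Q Z" and Zmin: "\<And>Z'. Q Z' \<Longrightarrow> card Z \<le> card Z'"
      by (metis arg_min_nat_lemma)
    have ZE: "Z \<subseteq> E" using Z XE by (auto simp: Q_def)
    show False
    proof (cases "\<forall>z\<in>Z. lt z x")
      case True
      then have "cl Z \<subseteq> cl {y \<in> E. lt y x}" using ZE by (intro cl_mono) auto
      then show False using Z x by (auto simp: Q_def X_def)
    next
      case False
      then have ne: "Z \<noteq> {}" by auto
      have "\<exists>m\<in>Z. \<forall>z\<in>Z - {m}. lt z m"
        using Z ne unfolding Q_def
      proof -
        assume "Z \<subseteq> X - {x} \<and> finite Z \<and> x \<in> cl Z"
        then have "finite Z" by simp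
        from this ne show ?thesis
        proof (induction rule: finite_ne_induct)
          case (singleton a) then show ?case by auto
        next
          case (insert a A)
          then obtain m where m: "m \<in> A" "\<forall>z\<in>A - {m}. lt z m" by auto
          show ?case
          proof (cases "lt a m")
            case True then show ?thesis using m by auto
          next
            case False
            then have "lt m a" using tot[of a m] insert m by auto
            then show ?thesis using m tr by (intro bexI[of _ a]) auto
          qed
        qed
      qed
      then obtain m where m: "m \<in> Z" "\<forall>z\<in>Z - {m}. lt z m" by auto
      obtain z where "z \<in> Z" "\<not> lt z x" using False by auto
      then have "lt x z" using tot[of x z] Z by (auto simp: Q_def)
      then have xm: "lt x m" using m \<open>z \<in> Z\<close> tr by (cases "z = m") auto
      have "x \<notin> cl (Z - {m})"
      proof
        assume "x \<in> cl (Z - {m})"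
        then have "Q (Z - {m})" using Z by (auto simp: Q_def)
        then have "card Z \<le> card (Z - {m})" using Zmin by blast
        moreover have "card (Z - {m}) < card Z" using m Z unfolding Q_def
          by (meson card_Diff1_less)
        ultimately show False by simp
      qed
      then have "m \<in> cl (insert x (Z - {m}))"
        using cl_exch[of "Z - {m}" m x] ZE m Z by (auto simp: Q_def insert_absorb)
      \<comment> \<open>Both \<open>x\<close> and the rest of \<open>Z\<close> precede
        \<open>m\<close>, so \<open>m\<close> depends on its predecessors and cannot have been kept
        in \<open>X\<close>.\<close>
      moreover have "cl (insert x (Z - {m})) \<subseteq> cl {y \<in> E. lt y m}"
        using ZE m xm x XE by (intro cl_mono) auto
      ultimately have "m \<notin> X" by (auto simp: X_def)
      then show False using m Z by (auto simp: Q_def)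
    qed
  qed
  ultimately show ?thesis unfolding basis_def by blast
qed

end


section \<open>Graded modules\<close>

context ring
begin

lemma fm_carrier_is_submodule: "is_submodule R r (fm_carrier R r)"
  by (auto simp: is_submodule_def fm_carrier_def fm_zero_def fm_add_def fm_smult_def)

lemma is_submoduleD:
  assumes "is_submodule R r N"
  shows "N \<subseteq> fm_carrier R r" "fm_zero R \<in> N"
    "v \<in> N \<Longrightarrow> w \<in> N \<Longrightarrow> fm_add R r v w \<in> N"
    "v \<in> N \<Longrightarrow> a \<in> carrier R \<Longrightarrow> fm_smult R r v a \<in> N"
  using assms by (auto simp: is_submodule_def)

lemma fm_zero_closed: "fm_zero R \<in> fm_carrier R r"
  and fm_add_closed: "v \<in> fm_carrier R r \<Longrightarrow> w \<in> fm_carrier R r \<Longrightarrow> fm_add R r v w \<in> fm_carrier R r"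
  and fm_smult_closed: "v \<in> fm_carrier R r \<Longrightarrow> a \<in> carrier R \<Longrightarrow> fm_smult R r v a \<in> fm_carrier R r"
  using is_submoduleD[OF fm_carrier_is_submodule] by auto

lemma submod_gen_incl: "G \<subseteq> submod_gen R r G"
  by (auto simp: submod_gen_def)

lemma submod_gen_least: "is_submodule R r N \<Longrightarrow> G \<subseteq> N \<Longrightarrow> submod_gen R r G \<subseteq> N"
  by (auto simp: submod_gen_def)

lemma submod_gen_mono: "G \<subseteq> G' \<Longrightarrow> submod_gen R r G \<subseteq> submod_gen R r G'"
  by (auto simp: submod_gen_def)

lemma submod_gen_is_submodule:
  assumes "G \<subseteq> fm_carrier R r"
  shows "is_submodule R r (submod_gen R r G)"
proof -
  have "submod_gen R r G \<subseteq> fm_carrier R r"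
    using assms fm_carrier_is_submodule by (intro submod_gen_least)
  then show ?thesis unfolding is_submodule_def submod_gen_def by blast
qed

lemma submod_gen_trans:
  "G \<subseteq> submod_gen R r G' \<Longrightarrow> G' \<subseteq> fm_carrier R r \<Longrightarrow> submod_gen R r G \<subseteq> submod_gen R r G'"
  by (intro submod_gen_least submod_gen_is_submodule)

text \<open>The submodules generated by finite subsets form a directed family, so their union is a
  submodule, and it contains \<open>G\<close>.\<close>

lemma submod_gen_finitary:
  assumes "G \<subseteq> fm_carrier R r" "v \<in> submod_gen R r G"
  shows "\<exists>F\<subseteq>G. finite F \<and> v \<in> submod_gen R r F"
proof -
  let ?U = "{v. \<exists>F\<subseteq>G. finite F \<and> v \<in> submod_gen R r F}"
  have sub: "is_submodule R r (submod_gen R r F)" if "F \<subseteq> G" for F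
    using that assms by (intro submod_gen_is_submodule) auto
  have "is_submodule R r ?U" unfolding is_submodule_def
  proof (intro conjI ballI)
    show "?U \<subseteq> fm_carrier R r" using sub is_submoduleD(1) by blast
    show "fm_zero R \<in> ?U" using sub[of "{}"] is_submoduleD(2) by blast
  next
    fix v w assume "v \<in> ?U" "w \<in> ?U"
    then obtain F1 F2 where F: "F1 \<subseteq> G" "finite F1" "v \<in> submod_gen R r F1"
      "F2 \<subseteq> G" "finite F2" "w \<in> submod_gen R r F2" by blast
    then have "v \<in> submod_gen R r (F1 \<union> F2)" "w \<in> submod_gen R r (F1 \<union> F2)"
      using submod_gen_mono[of F1 "F1 \<union> F2" r] submod_gen_mono[of F2 "F1 \<union> F2" r] by auto
    then have "fm_add R r v w \<in> submod_gen R r (F1 \<union> F2)"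
      using sub[of "F1 \<union> F2"] F by (auto intro: is_submoduleD)
    then show "fm_add R r v w \<in> ?U" using F by (intro CollectI exI[of _ "F1 \<union> F2"]) auto
  next
    fix v a assume "v \<in> ?U" and a: "a \<in> carrier R"
    then obtain F where F: "F \<subseteq> G" "finite F" "v \<in> submod_gen R r F" by blast
    then show "fm_smult R r v a \<in> ?U"
      using is_submoduleD(4)[OF sub[OF F(1)] F(3) a] by blast
  qed
  moreover have "G \<subseteq> ?U"
  proof
    fix g assume "g \<in> G"
    then show "g \<in> ?U" using submod_gen_incl[of "{g}"] by (intro CollectI exI[of _ "{g}"]) auto
  qed
  ultimately show ?thesis using submod_gen_least assms(2) by blast
qed

lemma fm_add_zero: "v \<in> fm_carrier R r \<Longrightarrow> fm_add R r v (fm_zero R) = v"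
  and fm_zero_add: "v \<in> fm_carrier R r \<Longrightarrow> fm_add R r (fm_zero R) v = v"
  and fm_smult_one: "v \<in> fm_carrier R r \<Longrightarrow> fm_smult R r v \<one> = v"
  and fm_smult_zero: "v \<in> fm_carrier R r \<Longrightarrow> fm_smult R r v \<zero> = fm_zero R"
  by (auto simp: fm_carrier_def fm_add_def fm_zero_def fm_smult_def)

lemma fm_zero_smult: "a \<in> carrier R \<Longrightarrow> fm_smult R r (fm_zero R) a = fm_zero R"
  by (auto simp: fm_zero_def fm_smult_def)

lemma fm_smult_add:
  "v \<in> fm_carrier R r \<Longrightarrow> a \<in> carrier R \<Longrightarrow> b \<in> carrier R \<Longrightarrow>
   fm_smult R r v (a \<oplus> b) = fm_add R r (fm_smult R r v a) (fm_smult R r v b)"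
  by (auto simp: fm_carrier_def fm_add_def fm_smult_def r_distr)

lemma fm_add_smult:
  "v \<in> fm_carrier R r \<Longrightarrow> w \<in> fm_carrier R r \<Longrightarrow> a \<in> carrier R \<Longrightarrow>
   fm_smult R r (fm_add R r v w) a = fm_add R r (fm_smult R r v a) (fm_smult R r w a)"
  by (auto simp: fm_carrier_def fm_add_def fm_smult_def l_distr)

lemma fm_smult_smult:
  "v \<in> fm_carrier R r \<Longrightarrow> a \<in> carrier R \<Longrightarrow> b \<in> carrier R \<Longrightarrow>
   fm_smult R r (fm_smult R r v a) b = fm_smult R r v (a \<otimes> b)"
  by (auto simp: fm_carrier_def fm_smult_def m_assoc)

lemma fm_add_4:
  "v \<in> fm_carrier R r \<Longrightarrow> w \<in> fm_carrier R r \<Longrightarrow> v' \<in> fm_carrier R r \<Longrightarrow> w' \<in> fm_carrier R r \<Longrightarrow>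
   fm_add R r (fm_add R r v w) (fm_add R r v' w') = fm_add R r (fm_add R r v v') (fm_add R r w w')"
  by (auto simp: fm_carrier_def fm_add_def a_ac)

text \<open>Isolates the coefficient of one generator, in preparation for the exchange law.\<close>

lemma submod_gen_insert:
  assumes g: "g \<in> fm_carrier R r" and G: "G \<subseteq> fm_carrier R r"
    and v: "v \<in> submod_gen R r (insert g G)"
  shows "\<exists>y\<in>submod_gen R r G. \<exists>b\<in>carrier R. v = fm_add R r y (fm_smult R r g b)"
proof -
  let ?U = "{fm_add R r y (fm_smult R r g b) |y b. y \<in> submod_gen R r G \<and> b \<in> carrier R}"
  note sm = is_submoduleD[OF submod_gen_is_submodule[OF G]]
  have "is_submodule R r ?U" unfolding is_submodule_def
  proof (intro conjI ballI)
    show "?U \<subseteq> fm_carrier R r" using sm(1) g by (auto intro!: fm_add_closed fm_smult_closed)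
    have "fm_zero R = fm_add R r (fm_zero R) (fm_smult R r g \<zero>)"
      using g by (simp add: fm_smult_zero fm_add_zero fm_zero_closed)
    then show "fm_zero R \<in> ?U" using sm(2) by blast
  next
    fix v w assume "v \<in> ?U" "w \<in> ?U"
    then obtain y b y' b' where y: "y \<in> submod_gen R r G" "b \<in> carrier R" "v = fm_add R r y (fm_smult R r g b)"
      "y' \<in> submod_gen R r G" "b' \<in> carrier R" "w = fm_add R r y' (fm_smult R r g b')" by blast
    have "fm_add R r v w = fm_add R r (fm_add R r y y') (fm_smult R r g (b \<oplus> b'))"
      using y g sm(1) by (simp add: fm_smult_add fm_add_4 fm_smult_closed subset_iff)
    then show "fm_add R r v w \<in> ?U" using sm(3) y by blast
  next
    fix v a assume "v \<in> ?U" and a: "a \<in> carrier R"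
    then obtain y b where y: "y \<in> submod_gen R r G" "b \<in> carrier R" "v = fm_add R r y (fm_smult R r g b)"
      by blast
    have "fm_smult R r v a = fm_add R r (fm_smult R r y a) (fm_smult R r g (b \<otimes> a))"
      using y g a sm(1) by (simp add: fm_add_smult fm_smult_smult fm_smult_closed subset_iff)
    then show "fm_smult R r v a \<in> ?U" using sm(4) y a by blast
  qed
  moreover have "insert g G \<subseteq> ?U"
  proof
    fix x assume "x \<in> insert g G"
    then show "x \<in> ?U"
    proof
      assume "x = g"
      then have "x = fm_add R r (fm_zero R) (fm_smult R r g \<one>)"
        using g by (simp add: fm_smult_one fm_zero_add)
      then show "x \<in> ?U" using sm(2) by blast
    next
      assume x: "x \<in> G"
      then have "x = fm_add R r x (fm_smult R r g \<zero>)"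
        using g G by (simp add: fm_smult_zero fm_add_zero subset_iff)
      then show "x \<in> ?U" using x submod_gen_incl[of G r] by blast
    qed
  qed
  ultimately have "submod_gen R r (insert g G) \<subseteq> ?U" by (rule submod_gen_least)
  then show ?thesis using v by blast
qed

end

text \<open>\<open>H d\<close> is homogeneity of degree \<open>d\<close> and \<open>comp d\<close>
  the projection to that degree. \<open>H_induct\<close> stands for the decomposition into finitely
  many components. \<open>H_inverse\<close> makes degree 0 behave like a division ring, the source
  of exchange.\<close>

locale graded_ring = ring B for B (structure) +
  fixes H :: "nat \<Rightarrow> 'a \<Rightarrow> bool" and comp :: "nat \<Rightarrow> 'a \<Rightarrow> 'a"
  assumes H_carrier: "H d x \<Longrightarrow> x \<in> carrier B"
    and H_comp: "x \<in> carrier B \<Longrightarrow> H d (comp d x)"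
    and comp_add: "x \<in> carrier B \<Longrightarrow> y \<in> carrier B \<Longrightarrow> comp d (x \<oplus> y) = comp d x \<oplus> comp d y"
    and comp_H: "H e x \<Longrightarrow> comp d x = (if d = e then x else \<zero>)"
    and H_mult: "H d x \<Longrightarrow> H e y \<Longrightarrow> H (d + e) (x \<otimes> y)"
    and H_inverse: "H 0 x \<Longrightarrow> x \<noteq> \<zero> \<Longrightarrow> \<exists>y\<in>carrier B. x \<otimes> y = \<one>"
    and H_induct: "x \<in> carrier B \<Longrightarrow>
      (\<And>x y. x \<in> carrier B \<Longrightarrow> y \<in> carrier B \<Longrightarrow> P x \<Longrightarrow> P y \<Longrightarrow> P (x \<oplus> y)) \<Longrightarrow>
      (\<And>d x. H d x \<Longrightarrow> P x) \<Longrightarrow> P x"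
begin

lemmas gen_induct = H_induct[consumes 1, case_names add hom]

lemma comp_closed: "x \<in> carrier B \<Longrightarrow> comp d x \<in> carrier B"
  using H_carrier H_comp by blast

lemma comp_zero: "comp d \<zero> = \<zero>"
proof -
  have "comp d \<zero> = comp d \<zero> \<oplus> comp d \<zero>" using comp_add[of \<zero> \<zero> d] by simp
  then show ?thesis using comp_closed[of \<zero> d] by (metis add.l_cancel_one' zero_closed)
qed

lemma H_zero: "H d \<zero>"
  using H_comp[of \<zero> d] comp_zero by simp

lemma comp_mult:
  assumes "x \<in> carrier B" and b: "H f b"
  shows "comp d (x \<otimes> b) = (if f \<le> d then comp (d - f) x \<otimes> b else \<zero>)"
  using assms(1)
proof (induction rule: gen_induct)
  case (add x y)
  then show ?case using H_carrier[OF b] by (auto simp: l_distr comp_add comp_closed)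
next
  case (hom e x)
  show ?case using comp_H[OF H_mult[OF hom b]] comp_H[OF hom] H_carrier[OF b] by auto
qed

section \<open>Homogeneous components in shifted free modules\<close>

context
  fixes r :: nat and \<delta> :: "nat \<Rightarrow> nat"
begin

abbreviation hom :: "nat \<Rightarrow> (nat \<Rightarrow> 'a) \<Rightarrow> bool" where
  "hom \<equiv> fm_hom B H r \<delta>"

text \<open>The guard \<open>\<delta> i \<le> d\<close> is essential: truncated subtraction would
  otherwise select the degree 0 component of coordinates whose basis vector has degree above
  \<open>d\<close>.\<close>

definition mcomp :: "nat \<Rightarrow> (nat \<Rightarrow> 'a) \<Rightarrow> nat \<Rightarrow> 'a" where
  "mcomp d v = (\<lambda>i. if i < r \<and> \<delta> i \<le> d then comp (d - \<delta> i) (v i) else \<zero>)"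

lemma hom_carrier: "hom d v \<Longrightarrow> v \<in> fm_carrier B r"
  by (simp add: fm_hom_def)

lemma hom_zero: "hom d (fm_zero B)"
  by (auto simp: fm_hom_def fm_zero_closed) (simp_all add: fm_zero_def H_zero)

lemma mcomp_hom: "hom e v \<Longrightarrow> mcomp d v = (if d = e then v else fm_zero B)"
proof -
  assume h: "hom e v"
  have "mcomp d v i = (if d = e then v else fm_zero B) i" for i
  proof (cases "i < r")
    case False
    then show ?thesis using h by (auto simp: mcomp_def fm_hom_def fm_carrier_def fm_zero_def)
  next
    case True
    show ?thesis
    proof (cases "\<delta> i \<le> e")
      case True
      then have "H (e - \<delta> i) (v i)" using h \<open>i < r\<close> by (auto simp: fm_hom_def)
      from comp_H[OF this] show ?thesis using True \<open>i < r\<close> by (auto simp: mcomp_def fm_zero_def)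
    next
      case False
      then have "v i = \<zero>" using h \<open>i < r\<close> by (auto simp: fm_hom_def)
      then show ?thesis using \<open>i < r\<close> by (auto simp: mcomp_def fm_zero_def comp_zero)
    qed
  qed
  then show ?thesis by blast
qed

lemma hom_unique: "hom d v \<Longrightarrow> hom e v \<Longrightarrow> v \<noteq> fm_zero B \<Longrightarrow> d = e"
  using mcomp_hom[of d v d] mcomp_hom[of e v d] by (auto split: if_splits)

lemma mcomp_add:
  "v \<in> fm_carrier B r \<Longrightarrow> w \<in> fm_carrier B r \<Longrightarrow> mcomp d (fm_add B r v w) = fm_add B r (mcomp d v) (mcomp d w)"
  by (auto simp: mcomp_def fm_carrier_def fm_add_def comp_add)

lemma mcomp_smult:
  assumes "v \<in> fm_carrier B r" "H f b"
  shows "mcomp d (fm_smult B r v b) = (if f \<le> d then fm_smult B r (mcomp (d - f) v) b else fm_zero B)"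
proof
  fix i
  show "mcomp d (fm_smult B r v b) i = (if f \<le> d then fm_smult B r (mcomp (d - f) v) b else fm_zero B) i"
  proof (cases "i < r \<and> \<delta> i \<le> d")
    case True
    then have "mcomp d (fm_smult B r v b) i = (if f \<le> d - \<delta> i then comp (d - \<delta> i - f) (v i) \<otimes> b else \<zero>)"
      using comp_mult[OF _ assms(2), of "v i" "d - \<delta> i"] assms(1)
      by (auto simp: mcomp_def fm_smult_def fm_carrier_def)
    also have "d - \<delta> i - f = d - f - \<delta> i" by simp
    finally show ?thesis using True H_carrier[OF assms(2)]
      by (auto simp: mcomp_def fm_smult_def fm_zero_def)
  next
    case False
    then show ?thesis using H_carrier[OF assms(2)] by (auto simp: mcomp_def fm_smult_def fm_zero_def)
  qed
qed

text \<open>A component of positive degree in \<open>b\<close> moves \<open>g\<close> out of degree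
  \<open>d\<close>. In the exchange argument this turns a coefficient into one of degree 0.\<close>

lemma mcomp_smult_hom:
  assumes g: "hom d g" and "b \<in> carrier B"
  shows "mcomp d (fm_smult B r g b) = fm_smult B r g (comp 0 b)"
  using assms(2)
proof (induction rule: gen_induct)
  case (add x y)
  then show ?case using hom_carrier[OF g]
    by (simp add: fm_smult_add comp_add mcomp_add fm_smult_closed comp_closed)
next
  case (hom f b)
  show ?case using mcomp_smult[OF hom_carrier[OF g] hom, of d] mcomp_hom[OF g, of "d - f"]
      comp_H[OF hom, of 0] H_carrier[OF hom] hom_carrier[OF g]
    by (auto simp: fm_zero_smult fm_smult_zero)
qed

text \<open>Scalars never lower degrees, so generators of degree above \<open>d\<close> cannot
  contribute to degree \<open>d\<close>. All \<open>d\<close> are treated at once, because a scalar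
  of degree \<open>f\<close> leads from \<open>d\<close> to \<open>d - f\<close>.\<close>

lemma mcomp_submod_gen:
  assumes G: "\<forall>g\<in>G. \<exists>d. hom d g" and v: "v \<in> submod_gen B r G"
  shows "mcomp d v \<in> submod_gen B r {g \<in> G. \<exists>e\<le>d. hom e g}"
proof -
  let ?G = "\<lambda>d. {g \<in> G. \<exists>e\<le>d. hom e g}"
  let ?X = "{v \<in> fm_carrier B r. \<forall>d. mcomp d v \<in> submod_gen B r (?G d)}"
  have sm: "is_submodule B r (submod_gen B r (?G d))" for d
    using hom_carrier by (intro submod_gen_is_submodule) auto
  note smD = is_submoduleD[OF sm]
  have "is_submodule B r ?X" unfolding is_submodule_def
  proof (intro conjI ballI)
    show "fm_zero B \<in> ?X" using smD(2) mcomp_hom[OF hom_zero] by (auto simp: fm_zero_closed)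
  next
    fix v w assume "v \<in> ?X" "w \<in> ?X"
    then show "fm_add B r v w \<in> ?X" using smD(3) by (auto simp: mcomp_add fm_add_closed)
  next
    fix v b assume v: "v \<in> ?X" and b: "b \<in> carrier B"
    have "\<forall>d. mcomp d (fm_smult B r v b) \<in> submod_gen B r (?G d)" using b
    proof (induction rule: gen_induct)
      case (add x y)
      then show ?case using v smD(3) by (simp add: fm_smult_add mcomp_add fm_smult_closed)
    next
      case (hom f b)
      show ?case
      proof
        fix d
        have "fm_smult B r (mcomp (d - f) v) b \<in> submod_gen B r (?G (d - f))"
          using v smD(4) H_carrier[OF hom] by auto
        moreover have "submod_gen B r (?G (d - f)) \<subseteq> submod_gen B r (?G d)"
          by (intro submod_gen_mono) (blast intro: order_trans[OF _ diff_le_self])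
        ultimately show "mcomp d (fm_smult B r v b) \<in> submod_gen B r (?G d)"
          using mcomp_smult[OF _ hom, of v d] v smD(2) by auto
      qed
    qed
    then show "fm_smult B r v b \<in> ?X" using v b by (auto simp: fm_smult_closed)
  qed auto
  moreover have "G \<subseteq> ?X"
  proof
    fix g assume g: "g \<in> G"
    then obtain e where e: "hom e g" using G by blast
    then have "mcomp d g \<in> submod_gen B r (?G d)" for d
      using mcomp_hom[OF e, of d] smD(2) submod_gen_incl[of "?G d" r] g by (cases "d = e") auto
    then show "g \<in> ?X" using hom_carrier[OF e] by auto
  qed
  ultimately show ?thesis using submod_gen_least v by blast
qed

text \<open>Homogeneous elements of degree \<open>d\<close> generate each other modulo the part of \<open>N\<close> generated in
  lower degrees like vectors over the division ring \<open>B\<^sub>0\<close>.\<close>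

definition Epart :: "(nat \<Rightarrow> 'a) set \<Rightarrow> nat \<Rightarrow> (nat \<Rightarrow> 'a) set" where
  "Epart N d = {v \<in> N. hom d v}"

definition Tpart :: "(nat \<Rightarrow> 'a) set \<Rightarrow> nat \<Rightarrow> (nat \<Rightarrow> 'a) set" where
  "Tpart N d = {v \<in> N. \<exists>e<d. hom e v}"

definition clos :: "(nat \<Rightarrow> 'a) set \<Rightarrow> nat \<Rightarrow> (nat \<Rightarrow> 'a) set \<Rightarrow> (nat \<Rightarrow> 'a) set" where
  "clos N d X = {v \<in> Epart N d. v \<in> submod_gen B r (Tpart N d \<union> X)}"

text \<open>For exchange, a relation \<open>b = y + a c\<close> is cut down to degree
  \<open>d\<close>. There \<open>c\<close> becomes an element of degree 0; it is nonzero because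
  \<open>b\<close> lies outside the closure of \<open>X\<close>, hence invertible, and the relation
  can be solved for \<open>a\<close>.\<close>

lemma pregeometry_clos:
  assumes N: "is_submodule B r N"
  shows "pregeometry (Epart N d) (clos N d)"
proof
  have TX: "Tpart N d \<union> X \<subseteq> fm_carrier B r" if "X \<subseteq> Epart N d" for X :: "(nat \<Rightarrow> 'a) set"
    using that is_submoduleD(1)[OF N] by (auto simp: Tpart_def Epart_def)
  fix X :: "(nat \<Rightarrow> 'a) set" assume XE: "X \<subseteq> Epart N d"
  note TXX = TX[OF XE]
  show "clos N d X \<subseteq> Epart N d" by (auto simp: clos_def)
  show "X \<subseteq> clos N d X" using XE submod_gen_incl[of "Tpart N d \<union> X" r] by (auto simp: clos_def)
  show "clos N d (clos N d X) \<subseteq> clos N d X"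
  proof -
    have "Tpart N d \<union> clos N d X \<subseteq> submod_gen B r (Tpart N d \<union> X)"
      using submod_gen_incl[of "Tpart N d \<union> X" r] by (auto simp: clos_def)
    from submod_gen_trans[OF this TXX] show ?thesis by (auto simp: clos_def)
  qed
  {
    fix a assume a: "a \<in> clos N d X"
    then obtain F where F: "F \<subseteq> Tpart N d \<union> X" "finite F" "a \<in> submod_gen B r F"
      using submod_gen_finitary[OF TXX, of a] by (auto simp: clos_def)
    have "submod_gen B r F \<subseteq> submod_gen B r (Tpart N d \<union> (F \<inter> X))"
      using F by (intro submod_gen_mono) auto
    then have "a \<in> clos N d (F \<inter> X)" using a F by (auto simp: clos_def)
    then show "\<exists>Y\<subseteq>X. finite Y \<and> a \<in> clos N d Y" using F by (intro exI[of _ "F \<inter> X"]) auto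
  }
  {
    fix a b assume a: "a \<in> Epart N d" and b: "b \<in> clos N d (insert a X)" "b \<notin> clos N d X"
    have homa: "hom d a" and homb: "hom d b" using a b by (auto simp: Epart_def clos_def)
    have bE: "b \<in> Epart N d" using b by (simp add: clos_def)
    let ?Y = "Tpart N d \<union> X"
    note sm = is_submoduleD[OF submod_gen_is_submodule[OF TXX]]
    have "b \<in> submod_gen B r (insert a ?Y)" using b by (simp add: clos_def)
    then obtain y c where y: "y \<in> submod_gen B r ?Y" and c: "c \<in> carrier B"
      and bb: "b = fm_add B r y (fm_smult B r a c)"
      using submod_gen_insert[OF hom_carrier[OF homa] TXX] by blast
    define y' where "y' = mcomp d y"
    define c' where "c' = comp 0 c"
    have c'c: "c' \<in> carrier B" using c by (simp add: c'_def comp_closed)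
    have y': "y' \<in> submod_gen B r ?Y"
    proof -
      have "\<forall>g\<in>?Y. \<exists>d. hom d g" using XE by (auto simp: Tpart_def Epart_def)
      from mcomp_submod_gen[OF this y, of d] show ?thesis
        using submod_gen_mono[of "{g \<in> ?Y. \<exists>e\<le>d. hom e g}" ?Y r] by (auto simp: y'_def)
    qed
    have yc: "y \<in> fm_carrier B r" "y' \<in> fm_carrier B r" using y y' sm(1) by auto
    note ac = hom_carrier[OF homa]
    have b': "b = fm_add B r y' (fm_smult B r a c')"
    proof -
      have "b = mcomp d b" using mcomp_hom[OF homb, of d] by simp
      also have "\<dots> = fm_add B r y' (mcomp d (fm_smult B r a c))"
        unfolding bb y'_def using yc ac c by (simp add: mcomp_add fm_smult_closed)
      finally show ?thesis using mcomp_smult_hom[OF homa c] by (simp add: c'_def)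
    qed
    have "c' \<noteq> \<zero>"
    proof
      assume "c' = \<zero>"
      then have "b = y'" using b' ac yc by (simp add: fm_smult_zero fm_add_zero)
      then show False using b y' bE by (simp add: clos_def)
    qed
    then obtain u where u: "u \<in> carrier B" "c' \<otimes> u = \<one>"
      using H_inverse[of c'] H_comp[OF c, of 0] by (auto simp: c'_def)
    \<comment> \<open>From \<open>b = y' + a c'\<close> and \<open>c' u = 1\<close> follows
      \<open>a = (b - y') u\<close>.\<close>
    have "a = fm_add B r (fm_smult B r b u) (fm_smult B r y' (\<ominus> u))"
    proof
      fix i
      show "a i = fm_add B r (fm_smult B r b u) (fm_smult B r y' (\<ominus> u)) i"
      proof (cases "i < r")
        case True
        then have cc: "a i \<in> carrier B" "y' i \<in> carrier B" using ac yc by (auto simp: fm_carrier_def)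
        have "(y' i \<oplus> a i \<otimes> c') \<otimes> u \<oplus> y' i \<otimes> \<ominus> u = a i \<otimes> (c' \<otimes> u)"
          using cc u(1) c'c by algebra
        then show ?thesis using True u(2) cc by (simp add: b' fm_add_def fm_smult_def)
      next
        case False
        then show ?thesis using ac by (simp add: fm_carrier_def fm_add_def)
      qed
    qed
    moreover have "is_submodule B r (submod_gen B r (Tpart N d \<union> insert b X))"
      using XE bE by (intro submod_gen_is_submodule TX) auto
    note sm2 = is_submoduleD[OF this]
    have "y' \<in> submod_gen B r (Tpart N d \<union> insert b X)"
      using y' submod_gen_mono[of ?Y "Tpart N d \<union> insert b X" r] by auto
    moreover have "b \<in> submod_gen B r (Tpart N d \<union> insert b X)"
      using submod_gen_incl[of "Tpart N d \<union> insert b X" r] by auto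
    ultimately have "a \<in> submod_gen B r (Tpart N d \<union> insert b X)"
      using sm2(3,4) u(1) by simp
    then show "a \<in> clos N d (insert b X)" using a by (simp add: clos_def)
  }
next
  fix X Y :: "(nat \<Rightarrow> 'a) set" assume "X \<subseteq> Y"
  then have "submod_gen B r (Tpart N d \<union> X) \<subseteq> submod_gen B r (Tpart N d \<union> Y)"
    by (intro submod_gen_mono) auto
  then show "clos N d X \<subseteq> clos N d Y" by (auto simp: clos_def)
qed

text \<open>Elements of \<open>N\<close> of degree below \<open>d\<close> need only generators of
  degree below \<open>d\<close>. So \<open>Tpart N d\<close> is generated without any
  \<open>g\<close> of degree \<open>d\<close>, and a dependence in the pregeometry would contradict
  minimality of \<open>G\<close>.\<close>

lemma min_basis_degree_part:
  assumes N: "is_submodule B r N" and G: "is_min_basis B H r \<delta> N G"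
  shows "pregeometry.basis (Epart N d) (clos N d) {g \<in> G. hom d g}"
proof -
  interpret pregeometry "Epart N d" "clos N d" using pregeometry_clos[OF N] .
  have Gh: "\<forall>g\<in>G. \<exists>d. hom d g" and GN: "submod_gen B r G = N"
    and Gm: "\<And>g. g \<in> G \<Longrightarrow> g \<notin> submod_gen B r (G - {g})"
    using G by (auto simp: is_min_basis_def is_basis_def is_homogeneous_def)
  have Gc: "G \<subseteq> fm_carrier B r" using Gh hom_carrier by blast
  \<comment> \<open>Zero lies in every submodule, so minimality excludes it. It is the only element
    with more than one degree, so degrees in \<open>G\<close> are unique.\<close>
  have G0: "g \<noteq> fm_zero B" if "g \<in> G" for g
    using Gm[OF that] is_submoduleD(2)[OF submod_gen_is_submodule[of "G - {g}" r]] Gc by auto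
  have low: "v \<in> submod_gen B r {g \<in> G. \<exists>e\<le>d. hom e g}" if "v \<in> N" "hom d v" for v d
    using mcomp_submod_gen[OF Gh, of v d] mcomp_hom[OF that(2), of d] that(1) GN by auto
  have GE: "{g \<in> G. hom d g} \<subseteq> Epart N d"
    using submod_gen_incl[of G r] GN by (auto simp: Epart_def)
  show ?thesis unfolding basis_def indep_def
  proof (intro conjI ballI GE notI subsetI)
    fix g assume g: "g \<in> {g \<in> G. hom d g}" "g \<in> clos N d ({g \<in> G. hom d g} - {g})"
    have "Tpart N d \<subseteq> submod_gen B r (G - {g})"
    proof
      fix v assume "v \<in> Tpart N d"
      then obtain e where e: "e < d" "hom e v" "v \<in> N" by (auto simp: Tpart_def)
      have "{h \<in> G. \<exists>e'\<le>e. hom e' h} \<subseteq> G - {g}"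
      proof
        fix h assume h: "h \<in> {h \<in> G. \<exists>e'\<le>e. hom e' h}"
        then obtain e' where "e' \<le> e" "hom e' h" by blast
        moreover have "e' = d" if "h = g"
          using that \<open>hom e' h\<close> g G0 by (intro hom_unique[of _ g]) auto
        ultimately show "h \<in> G - {g}" using h e(1) by auto
      qed
      from submod_gen_mono[OF this] show "v \<in> submod_gen B r (G - {g})"
        using low[OF e(3,2)] by auto
    qed
    then have "Tpart N d \<union> ({g \<in> G. hom d g} - {g}) \<subseteq> submod_gen B r (G - {g})"
      using submod_gen_incl[of "G - {g}" r] by auto
    from submod_gen_trans[OF this] have "g \<in> submod_gen B r (G - {g})"
      using g Gc by (auto simp: clos_def)
    then show False using Gm g by auto
  next
    fix v assume v: "v \<in> Epart N d"
    have "{g \<in> G. \<exists>e\<le>d. hom e g} \<subseteq> Tpart N d \<union> {g \<in> G. hom d g}"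
      using submod_gen_incl[of G r] GN by (auto simp: Tpart_def le_less)
    from submod_gen_mono[OF this] have "v \<in> submod_gen B r (Tpart N d \<union> {g \<in> G. hom d g})"
      using low[of v d] v by (auto simp: Epart_def)
    then show "v \<in> clos N d {g \<in> G. hom d g}" using v by (simp add: clos_def)
  qed
qed

theorem min_basis_card_eq:
  assumes N: "is_submodule B r N"
    and "is_min_basis B H r \<delta> N G" "is_min_basis B H r \<delta> N G'"
  shows "card {g \<in> G. hom d g} = card {g \<in> G'. hom d g}"
proof -
  interpret pregeometry "Epart N d" "clos N d" using pregeometry_clos[OF N] .
  show ?thesis using assms by (intro basis_card_eq min_basis_degree_part)
qed

text \<open>Pregeometry bases chosen independently in all degrees fit together. They generate by
  induction on the degree, since \<open>Tpart N d\<close> lives in smaller degrees. They are minimal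
  because a relation for an element of degree \<open>d\<close> uses only generators of degree at
  most \<open>d\<close>, and those of smaller degree are already absorbed in
  \<open>Tpart N d\<close>.\<close>

theorem min_basis_exists:
  assumes "is_graded_submodule B H r \<delta> N"
  shows "\<exists>G. is_min_basis B H r \<delta> N G"
proof -
  have N: "is_submodule B r N" and Ngen: "N = submod_gen B r {v \<in> N. \<exists>d. hom d v}"
    using assms by (simp_all add: is_graded_submodule_def is_homogeneous_def)
  have "\<forall>d. \<exists>X. pregeometry.basis (Epart N d) (clos N d) X"
    using pregeometry.basis_exists[OF pregeometry_clos[OF N]] by blast
  then obtain X where X: "\<And>d. pregeometry.basis (Epart N d) (clos N d) (X d)" by metis
  have XE: "X d \<subseteq> Epart N d" and Xi: "\<And>x. x \<in> X d \<Longrightarrow> x \<notin> clos N d (X d - {x})"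
    and Xs: "Epart N d \<subseteq> clos N d (X d)" for d
    using X[of d] pregeometry.basis_def[OF pregeometry_clos[OF N]]
      pregeometry.indep_def[OF pregeometry_clos[OF N]] by blast+
  define G where "G = (\<Union>d. X d)"
  have Xh: "hom d x" "x \<in> N" if "x \<in> X d" for x d using that XE by (auto simp: Epart_def)
  have Gc: "G \<subseteq> fm_carrier B r" using Xh(1) hom_carrier unfolding G_def by blast
  have GN: "G \<subseteq> N" using Xh by (auto simp: G_def)
  have "Epart N d \<subseteq> submod_gen B r G" for d
  proof (induction d rule: less_induct)
    case (less d)
    have "Tpart N d \<subseteq> submod_gen B r G" using less by (force simp: Tpart_def Epart_def)
    moreover have "X d \<subseteq> submod_gen B r G" using submod_gen_incl[of G r] by (auto simp: G_def)
    ultimately have "submod_gen B r (Tpart N d \<union> X d) \<subseteq> submod_gen B r G"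
      using Gc by (intro submod_gen_trans) auto
    then show ?case using Xs[of d] by (auto simp: clos_def)
  qed
  then have "{v \<in> N. \<exists>d. hom d v} \<subseteq> submod_gen B r G" by (auto simp: Epart_def)
  then have "N \<subseteq> submod_gen B r G" using Ngen submod_gen_trans[OF _ Gc] by blast
  then have gen: "submod_gen B r G = N" using submod_gen_least[OF N GN] by blast
  have G0: "x \<noteq> fm_zero B" if "x \<in> X d" for x d
  proof
    assume x: "x = fm_zero B"
    have "is_submodule B r (submod_gen B r (Tpart N d \<union> (X d - {x})))"
      using XE is_submoduleD(1)[OF N] by (intro submod_gen_is_submodule) (auto simp: Epart_def Tpart_def)
    then have "x \<in> clos N d (X d - {x})"
      using is_submoduleD(2) x that XE by (auto simp: clos_def)
    then show False using Xi that by blast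
  qed
  have "g \<notin> submod_gen B r (G - {g})" if g: "g \<in> G" for g
  proof
    assume g': "g \<in> submod_gen B r (G - {g})"
    obtain d where d: "g \<in> X d" using g by (auto simp: G_def)
    have "g \<in> submod_gen B r {h \<in> G - {g}. \<exists>e\<le>d. hom e h}"
    proof -
      have "\<forall>h\<in>G - {g}. \<exists>d. hom d h" using Xh(1) unfolding G_def by blast
      from mcomp_submod_gen[OF this g', of d] show ?thesis
        using mcomp_hom[OF Xh(1)[OF d], of d] by simp
    qed
    moreover have "{h \<in> G - {g}. \<exists>e\<le>d. hom e h} \<subseteq> Tpart N d \<union> (X d - {g})"
    proof
      fix h assume "h \<in> {h \<in> G - {g}. \<exists>e\<le>d. hom e h}"
      then obtain e e' where h: "h \<noteq> g" "e \<le> d" "hom e h" "h \<in> X e'" by (auto simp: G_def)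
      then have "e = e'" using hom_unique[OF _ Xh(1) G0] by blast
      then show "h \<in> Tpart N d \<union> (X d - {g})"
        using h Xh(2)[OF h(4)] by (cases "e = d") (auto simp: Tpart_def)
    qed
    ultimately have "g \<in> submod_gen B r (Tpart N d \<union> (X d - {g}))"
      using submod_gen_mono by (meson subsetD)
    then have "g \<in> clos N d (X d - {g})" using XE d by (auto simp: clos_def)
    then show False using Xi d by blast
  qed
  then have "is_min_basis B H r \<delta> N G"
    using gen Xh by (auto simp: is_min_basis_def is_basis_def is_homogeneous_def G_def)
  then show ?thesis by blast
qed

end

end

section \<open>Transfer along shifted embeddings\<close>

text \<open>\<open>j k\<close> plays the role of \<open>\<sigma>\<^sup>k \<circ> \<iota>\<close>; \<open>q k\<close> is a linear retraction of it.\<close>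

locale shifted_embedding =
  A: graded_ring A HA cA + S: graded_ring S HS cS
  for A :: "('a, 'c) ring_scheme" and HA cA and S :: "('b, 'd) ring_scheme" and HS cS +
  fixes j :: "nat \<Rightarrow> 'a \<Rightarrow> 'b" and q :: "nat \<Rightarrow> 'b \<Rightarrow> 'a"
  assumes j_closed: "a \<in> carrier A \<Longrightarrow> j k a \<in> carrier S"
    and q_closed: "s \<in> carrier S \<Longrightarrow> q k s \<in> carrier A"
    and j_add: "a \<in> carrier A \<Longrightarrow> b \<in> carrier A \<Longrightarrow> j k (a \<oplus>\<^bsub>A\<^esub> b) = j k a \<oplus>\<^bsub>S\<^esub> j k b"
    and q_add: "s \<in> carrier S \<Longrightarrow> t \<in> carrier S \<Longrightarrow> q k (s \<oplus>\<^bsub>S\<^esub> t) = q k s \<oplus>\<^bsub>A\<^esub> q k t"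
    and j_hom: "HA e a \<Longrightarrow> HS e (j k a)"
    and q_hom: "HS e s \<Longrightarrow> HA e (q k s)"
    and q_j: "a \<in> carrier A \<Longrightarrow> q k (j k a) = a"
    and q_mult: "HA e a \<Longrightarrow> s \<in> carrier S \<Longrightarrow> q k (j k a \<otimes>\<^bsub>S\<^esub> s) = a \<otimes>\<^bsub>A\<^esub> q (k + e) s"
    and j_mult: "HA e a \<Longrightarrow> b \<in> carrier A \<Longrightarrow> j k (a \<otimes>\<^bsub>A\<^esub> b) = j k a \<otimes>\<^bsub>S\<^esub> j (k + e) b"
begin

lemma j_zero: "j k \<zero>\<^bsub>A\<^esub> = \<zero>\<^bsub>S\<^esub>"
  using j_add[of "\<zero>\<^bsub>A\<^esub>" "\<zero>\<^bsub>A\<^esub>" k] j_closed[of "\<zero>\<^bsub>A\<^esub>" k]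
  by (metis A.l_zero A.zero_closed S.add.l_cancel_one' S.zero_closed)

lemma q_zero: "q k \<zero>\<^bsub>S\<^esub> = \<zero>\<^bsub>A\<^esub>"
  using q_add[of "\<zero>\<^bsub>S\<^esub>" "\<zero>\<^bsub>S\<^esub>" k] q_closed[of "\<zero>\<^bsub>S\<^esub>" k]
  by (metis S.l_zero S.zero_closed A.add.l_cancel_one' A.zero_closed)

section \<open>Maps between the shifted free modules\<close>

context
  fixes r :: nat and \<delta> :: "nat \<Rightarrow> nat"
begin

definition jm :: "(nat \<Rightarrow> 'a) \<Rightarrow> nat \<Rightarrow> 'b" where
  "jm v = (\<lambda>i. if i < r then j (\<delta> i) (v i) else \<zero>\<^bsub>S\<^esub>)"

definition qm :: "(nat \<Rightarrow> 'b) \<Rightarrow> nat \<Rightarrow> 'a" where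
  "qm v = (\<lambda>i. if i < r then q (\<delta> i) (v i) else \<zero>\<^bsub>A\<^esub>)"

abbreviation "homA' \<equiv> fm_hom A HA r \<delta>"
abbreviation "homS' \<equiv> fm_hom S HS r \<delta>"

lemma jm_closed: "v \<in> fm_carrier A r \<Longrightarrow> jm v \<in> fm_carrier S r"
  by (auto simp: fm_carrier_def jm_def j_closed)

lemma qm_closed: "v \<in> fm_carrier S r \<Longrightarrow> qm v \<in> fm_carrier A r"
  by (auto simp: fm_carrier_def qm_def q_closed)

lemma jm_add: "v \<in> fm_carrier A r \<Longrightarrow> w \<in> fm_carrier A r \<Longrightarrow> jm (fm_add A r v w) = fm_add S r (jm v) (jm w)"
  by (auto simp: fm_carrier_def jm_def fm_add_def j_add)

lemma qm_add: "v \<in> fm_carrier S r \<Longrightarrow> w \<in> fm_carrier S r \<Longrightarrow> qm (fm_add S r v w) = fm_add A r (qm v) (qm w)"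
  by (auto simp: fm_carrier_def qm_def fm_add_def q_add)

lemma jm_zero: "jm (fm_zero A) = fm_zero S"
  by (auto simp: jm_def fm_zero_def j_zero)

lemma qm_zero: "qm (fm_zero S) = fm_zero A"
  by (auto simp: qm_def fm_zero_def q_zero)

lemma qm_jm: "v \<in> fm_carrier A r \<Longrightarrow> qm (jm v) = v"
  by (auto simp: fm_carrier_def qm_def jm_def q_j)

lemma jm_hom: "homA' d v \<Longrightarrow> homS' d (jm v)"
  using jm_closed[of v] by (auto simp: fm_hom_def jm_def j_hom j_zero)

lemma qm_hom: "homS' d v \<Longrightarrow> homA' d (qm v)"
  using qm_closed[of v] by (auto simp: fm_hom_def qm_def q_hom q_zero)

text \<open>Coordinate \<open>i\<close> of \<open>g\<close> has degree \<open>d - \<delta> i\<close>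
  and is embedded with shift \<open>\<delta> i\<close>. Hence the index of \<open>q\<close> becomes
  \<open>\<delta> i + (d - \<delta> i) = d\<close> in every coordinate, and one scalar
  \<open>q d s\<close> serves them all.\<close>

lemma qm_mult:
  assumes g: "homA' d g" and s: "s \<in> carrier S"
  shows "qm (fm_smult S r (jm g) s) = fm_smult A r g (q d s)"
proof
  fix i
  show "qm (fm_smult S r (jm g) s) i = fm_smult A r g (q d s) i"
  proof (cases "i < r")
    case True
    show ?thesis
    proof (cases "\<delta> i \<le> d")
      case True
      then have "HA (d - \<delta> i) (g i)" using g \<open>i < r\<close> by (auto simp: fm_hom_def)
      from q_mult[OF this s, of "\<delta> i"] show ?thesis
        using True \<open>i < r\<close> by (simp add: qm_def jm_def fm_smult_def)
    next
      case False
      \<comment> \<open>Here the shift \<open>\<delta> i\<close> exceeds \<open>d\<close> and the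
        indices would not match, but the coordinate vanishes.\<close>
      then have "g i = \<zero>\<^bsub>A\<^esub>" using g \<open>i < r\<close> by (auto simp: fm_hom_def)
      then show ?thesis using s q_closed[OF s]
        by (simp add: qm_def jm_def fm_smult_def j_zero q_zero)
    qed
  qed (simp add: qm_def fm_smult_def)
qed

lemma jm_mult:
  assumes g: "homA' d g" and b: "b \<in> carrier A"
  shows "jm (fm_smult A r g b) = fm_smult S r (jm g) (j d b)"
proof
  fix i
  show "jm (fm_smult A r g b) i = fm_smult S r (jm g) (j d b) i"
  proof (cases "i < r")
    case True
    show ?thesis
    proof (cases "\<delta> i \<le> d")
      case True
      then have "HA (d - \<delta> i) (g i)" using g \<open>i < r\<close> by (auto simp: fm_hom_def)
      from j_mult[OF this b, of "\<delta> i"] show ?thesis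
        using True \<open>i < r\<close> by (simp add: jm_def fm_smult_def)
    next
      case False
      then have "g i = \<zero>\<^bsub>A\<^esub>" using g \<open>i < r\<close> by (auto simp: fm_hom_def)
      then show ?thesis using b j_closed[OF b]
        by (simp add: jm_def fm_smult_def j_zero)
    qed
  qed (simp add: jm_def fm_smult_def)
qed

lemma jm_submod_gen:
  assumes G: "\<forall>g\<in>G. \<exists>d. homA' d g" and v: "v \<in> submod_gen A r G"
  shows "jm v \<in> submod_gen S r (jm ` G)"
proof -
  have Gc: "G \<subseteq> fm_carrier A r" using G A.hom_carrier by blast
  then have "jm ` G \<subseteq> fm_carrier S r" using jm_closed by auto
  note sm = S.is_submoduleD[OF S.submod_gen_is_submodule[OF this]]
  \<comment> \<open>The rule for \<open>jm\<close> on multiples requires a homogeneous vector, so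
    the plain preimage is not visibly a submodule. Quantifying over all multiples reduces closure
    under scalars to associativity and leaves that rule for the generators alone.\<close>
  let ?X = "{v \<in> fm_carrier A r. \<forall>a\<in>carrier A. jm (fm_smult A r v a) \<in> submod_gen S r (jm ` G)}"
  have "is_submodule A r ?X" unfolding is_submodule_def
  proof (intro conjI ballI)
    show "fm_zero A \<in> ?X"
      using sm(2) by (simp add: A.fm_zero_closed A.fm_zero_smult jm_zero)
  next
    fix v w assume "v \<in> ?X" "w \<in> ?X"
    then show "fm_add A r v w \<in> ?X"
      using sm(3) by (simp add: A.fm_add_closed A.fm_add_smult jm_add A.fm_smult_closed)
  next
    fix v a assume "v \<in> ?X" "a \<in> carrier A"
    then show "fm_smult A r v a \<in> ?X" by (simp add: A.fm_smult_closed A.fm_smult_smult)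
  qed auto
  moreover have "G \<subseteq> ?X"
  proof
    fix g assume g: "g \<in> G"
    then obtain d where "homA' d g" using G by blast
    moreover have "jm g \<in> submod_gen S r (jm ` G)" using g S.submod_gen_incl by blast
    ultimately show "g \<in> ?X" using g Gc sm(4) by (auto simp: jm_mult j_closed)
  qed
  ultimately have "submod_gen A r G \<subseteq> ?X" by (rule A.submod_gen_least)
  then have "v \<in> ?X" using v by blast
  then show ?thesis using A.fm_smult_one[of v r] by (auto dest!: bspec[of _ _ "\<one>\<^bsub>A\<^esub>"])
qed

text \<open>The retraction brings \<open>L(N)\<close> back into \<open>N\<close>: on a multiple of a
  generator \<open>jm g\<close> it yields a right multiple of \<open>g\<close>.\<close>

lemma qm_submod_gen:
  assumes G: "\<forall>g\<in>G. \<exists>d. homA' d g" and v: "v \<in> submod_gen S r (jm ` G)"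
  shows "qm v \<in> submod_gen A r G"
proof -
  have Gc: "G \<subseteq> fm_carrier A r" using G A.hom_carrier by blast
  note sm = A.is_submoduleD[OF A.submod_gen_is_submodule[OF Gc]]
  \<comment> \<open>Same device as for \<open>jm\<close>: the retraction is not linear, so all
    multiples are required at once.\<close>
  let ?X = "{v \<in> fm_carrier S r. \<forall>a\<in>carrier S. qm (fm_smult S r v a) \<in> submod_gen A r G}"
  have "is_submodule S r ?X" unfolding is_submodule_def
  proof (intro conjI ballI)
    show "fm_zero S \<in> ?X"
      using sm(2) by (simp add: S.fm_zero_closed S.fm_zero_smult qm_zero)
  next
    fix v w assume "v \<in> ?X" "w \<in> ?X"
    then show "fm_add S r v w \<in> ?X"
      using sm(3) by (simp add: S.fm_add_closed S.fm_add_smult qm_add S.fm_smult_closed)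
  next
    fix v a assume "v \<in> ?X" "a \<in> carrier S"
    then show "fm_smult S r v a \<in> ?X" by (simp add: S.fm_smult_closed S.fm_smult_smult)
  qed auto
  moreover have "jm ` G \<subseteq> ?X"
  proof
    fix h assume "h \<in> jm ` G"
    then obtain g where g: "g \<in> G" "h = jm g" by blast
    then obtain d where "homA' d g" using G by blast
    moreover have "g \<in> submod_gen A r G" using g A.submod_gen_incl by blast
    ultimately show "h \<in> ?X" using g Gc sm(4) by (auto simp: qm_mult q_closed jm_closed)
  qed
  ultimately have "submod_gen S r (jm ` G) \<subseteq> ?X" by (rule S.submod_gen_least)
  then have "v \<in> ?X" using v by blast
  then show ?thesis using S.fm_smult_one[of v r] by (auto dest!: bspec[of _ _ "\<one>\<^bsub>S\<^esub>"])
qed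

text \<open>Contraction of the extended submodule returns the original one. Both generation and
  minimality are questions of such memberships.\<close>

lemma jm_mem_submod_gen_iff:
  assumes "\<forall>g\<in>G. \<exists>d. homA' d g" "v \<in> fm_carrier A r"
  shows "jm v \<in> submod_gen S r (jm ` G) \<longleftrightarrow> v \<in> submod_gen A r G"
  using jm_submod_gen[OF assms(1)] qm_submod_gen[OF assms(1), of "jm v"] qm_jm[OF assms(2)] by auto

lemma submod_gen_jm_image:
  assumes "\<forall>g\<in>G. \<exists>d. homA' d g"
  shows "submod_gen S r (jm ` submod_gen A r G) = submod_gen S r (jm ` G)"
proof
  have "jm ` G \<subseteq> fm_carrier S r" using assms A.hom_carrier jm_closed by blast
  then show "submod_gen S r (jm ` submod_gen A r G) \<subseteq> submod_gen S r (jm ` G)"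
    using jm_submod_gen[OF assms] by (intro S.submod_gen_trans) auto
  show "submod_gen S r (jm ` G) \<subseteq> submod_gen S r (jm ` submod_gen A r G)"
    using A.submod_gen_incl by (intro S.submod_gen_mono image_mono)
qed

lemma basis_transfer:
  assumes M: "is_graded_submodule A HA r \<delta> M"
    and G: "G \<subseteq> M" "\<forall>g\<in>G. \<exists>d. homA' d g"
  shows "is_basis A HA r \<delta> M G \<longleftrightarrow>
    is_basis S HS r \<delta> (submod_gen S r (jm ` M)) (jm ` G)"
proof
  assume "is_basis A HA r \<delta> M G"
  then have "submod_gen A r G = M" by (simp add: is_basis_def)
  then show "is_basis S HS r \<delta> (submod_gen S r (jm ` M)) (jm ` G)"
    using submod_gen_jm_image[OF G(2)] G(2) jm_hom by (fastforce simp: is_basis_def is_homogeneous_def)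
next
  have sM: "is_submodule A r M" using M by (simp add: is_graded_submodule_def)
  assume "is_basis S HS r \<delta> (submod_gen S r (jm ` M)) (jm ` G)"
  then have eq: "submod_gen S r (jm ` G) = submod_gen S r (jm ` M)" by (simp add: is_basis_def)
  have "M \<subseteq> submod_gen A r G"
  proof
    fix v assume v: "v \<in> M"
    then have "jm v \<in> submod_gen S r (jm ` G)" using eq S.submod_gen_incl[of "jm ` M" r] by auto
    then show "v \<in> submod_gen A r G"
      using jm_mem_submod_gen_iff[OF G(2), of v] A.is_submoduleD(1)[OF sM] v by auto
  qed
  then have "submod_gen A r G = M" using A.submod_gen_least[OF sM G(1)] by blast
  then show "is_basis A HA r \<delta> M G" using G by (auto simp: is_basis_def is_homogeneous_def)
qed

lemma min_basis_transfer:
  assumes M: "is_graded_submodule A HA r \<delta> M"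
    and G: "G \<subseteq> M" "\<forall>g\<in>G. \<exists>d. homA' d g"
  shows "is_min_basis A HA r \<delta> M G \<longleftrightarrow>
    is_min_basis S HS r \<delta> (submod_gen S r (jm ` M)) (jm ` G)"
proof -
  have Gc: "G \<subseteq> fm_carrier A r" using G A.hom_carrier by blast
  \<comment> \<open>Without injectivity, removing \<open>jm g\<close> from the image could remove
    the images of other generators too.\<close>
  have inj: "inj_on jm G" using qm_jm Gc by (intro inj_on_inverseI[where g = qm]) auto
  have "jm g \<in> submod_gen S r (jm ` G - {jm g}) \<longleftrightarrow> g \<in> submod_gen A r (G - {g})" if g: "g \<in> G" for g
  proof -
    have "jm ` G - {jm g} = jm ` (G - {g})" using inj g by (auto simp: inj_on_def)
    moreover have "\<forall>h\<in>G - {g}. \<exists>d. homA' d h" using G(2) by blast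
    ultimately show ?thesis using jm_mem_submod_gen_iff[of "G - {g}" g] g Gc by auto
  qed
  then show ?thesis using basis_transfer[OF M G] by (auto simp: is_min_basis_def)
qed

text \<open>The minimal basis chosen over \<open>A\<close> is carried to one over \<open>S\<close>,
  which shows that the choice over \<open>S\<close> also yields a minimal basis. The two over
  \<open>S\<close> are then compared by \<open>min_basis_card_eq\<close>.\<close>

lemma bnum_transfer:
  assumes M: "is_graded_submodule A HA r \<delta> M"
  shows "bnum A HA r \<delta> M d = bnum S HS r \<delta> (submod_gen S r (jm ` M)) d"
proof -
  let ?L = "submod_gen S r (jm ` M)"
  define G where "G = (SOME G. is_min_basis A HA r \<delta> M G)"
  define G' where "G' = (SOME G. is_min_basis S HS r \<delta> ?L G)"
  have Gm: "is_min_basis A HA r \<delta> M G"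
    unfolding G_def using A.min_basis_exists[OF M] by (rule someI_ex)
  have G: "G \<subseteq> M" "\<forall>g\<in>G. \<exists>d. homA' d g"
    using Gm A.submod_gen_incl[of G r] by (auto simp: is_min_basis_def is_basis_def is_homogeneous_def)
  have jG: "is_min_basis S HS r \<delta> ?L (jm ` G)" using min_basis_transfer[OF M G] Gm by simp
  then have G'm: "is_min_basis S HS r \<delta> ?L G'" unfolding G'_def by (rule someI)
  have Mc: "M \<subseteq> fm_carrier A r"
    using M A.is_submoduleD(1) by (auto simp: is_graded_submodule_def)
  then have "is_submodule S r ?L" using jm_closed by (intro S.submod_gen_is_submodule) auto
  from S.min_basis_card_eq[OF this G'm jG, of d]
  have "bnum S HS r \<delta> ?L d = card {g \<in> jm ` G. homS' d g}" by (simp add: bnum_def G'_def)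
  also have "{g \<in> jm ` G. homS' d g} = jm ` {g \<in> G. homA' d g}"
  proof -
    \<comment> \<open>The retraction also preserves degrees, so the embedding reflects them.\<close>
    have "homS' d (jm g) \<longleftrightarrow> homA' d g" if "g \<in> G" for g
      using jm_hom[of d g] qm_hom[of d "jm g"] qm_jm[of g] that G(1) Mc by auto
    then have "{g \<in> G. homS' d (jm g)} = {g \<in> G. homA' d g}" by (intro Collect_cong) auto
    then show ?thesis by (auto simp: set_eq_iff)
  qed
  also have "card \<dots> = card {g \<in> G. homA' d g}"
  proof (rule card_image)
    show "inj_on jm {g \<in> G. homA' d g}" using qm_jm A.hom_carrier by (intro inj_on_inverseI[where g = qm]) auto
  qed
  finally show ?thesis by (simp add: bnum_def G_def)
qed

end

end

section \<open>Finitely supported functions\<close>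

lemma pm_expand: "p = (\<Sum>m\<in>Poly_Mapping.keys p. Poly_Mapping.single m (Poly_Mapping.lookup p m))"
proof (rule poly_mapping_eqI)
  fix k
  show "Poly_Mapping.lookup p k =
    Poly_Mapping.lookup (\<Sum>m\<in>Poly_Mapping.keys p. Poly_Mapping.single m (Poly_Mapping.lookup p m)) k"
    by (auto simp: lookup_sum lookup_single when_def in_keys_iff sum.delta)
qed

text \<open>The single case concerns only terms occurring in \<open>p\<close>, so hypotheses on the
  support of \<open>p\<close> remain usable there.\<close>

lemma pm_induct [case_names single zero add]:
  fixes p :: "'a \<Rightarrow>\<^sub>0 'b::comm_monoid_add"
  assumes "\<And>m. m \<in> Poly_Mapping.keys p \<Longrightarrow> P (Poly_Mapping.single m (Poly_Mapping.lookup p m))"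
    and "P 0" and "\<And>x y. P x \<Longrightarrow> P y \<Longrightarrow> P (x + y)"
  shows "P p"
proof -
  have "finite K \<Longrightarrow> (\<And>m. m \<in> K \<Longrightarrow> P (f m)) \<Longrightarrow> P (\<Sum>m\<in>K. f m)" for K and f :: "'a \<Rightarrow> 'a \<Rightarrow>\<^sub>0 'b"
    by (induction K rule: finite_induct) (auto intro: assms)
  then show ?thesis using assms(1) by (subst pm_expand) auto
qed

text \<open>Common form of \<open>sigma_mon\<close>, \<open>sigmaP\<close> and
  \<open>iotaP\<close>.\<close>

definition push :: "('a \<Rightarrow> 'b) \<Rightarrow> ('a \<Rightarrow>\<^sub>0 'c::comm_monoid_add) \<Rightarrow> 'b \<Rightarrow>\<^sub>0 'c" where
  "push h p = (\<Sum>m\<in>Poly_Mapping.keys p. Poly_Mapping.single (h m) (Poly_Mapping.lookup p m))"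

lemma push_superset:
  "finite K \<Longrightarrow> Poly_Mapping.keys p \<subseteq> K \<Longrightarrow>
    push h p = (\<Sum>m\<in>K. Poly_Mapping.single (h m) (Poly_Mapping.lookup p m))"
  unfolding push_def by (rule sum.mono_neutral_left) (auto simp: in_keys_iff)

lemma push_zero [simp]: "push h 0 = 0"
  by (simp add: push_def)

lemma push_add: "push h (p + q) = push h p + push h q"
proof -
  let ?K = "Poly_Mapping.keys p \<union> Poly_Mapping.keys q"
  have "push h (p + q) = (\<Sum>m\<in>?K. Poly_Mapping.single (h m) (Poly_Mapping.lookup (p + q) m))"
    by (rule push_superset) (use keys_add[of p q] in auto)
  then show ?thesis
    by (simp add: push_superset[of ?K] lookup_add single_add sum.distrib)
qed

lemma push_single [simp]: "push h (Poly_Mapping.single m c) = Poly_Mapping.single (h m) c"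
  by (simp add: push_def)

lemma push_push: "push h (push g p) = push (h \<circ> g) p"
  by (induction p rule: pm_induct) (simp_all add: push_add)

lemma keys_push: "Poly_Mapping.keys (push h p) \<subseteq> h ` Poly_Mapping.keys p"
proof
  fix x assume "x \<in> Poly_Mapping.keys (push h p)"
  then have "(\<Sum>m\<in>Poly_Mapping.keys p. Poly_Mapping.lookup (Poly_Mapping.single (h m) (Poly_Mapping.lookup p m)) x) \<noteq> 0"
    by (simp add: push_def in_keys_iff lookup_sum)
  then obtain m where "m \<in> Poly_Mapping.keys p"
    "Poly_Mapping.lookup (Poly_Mapping.single (h m) (Poly_Mapping.lookup p m)) x \<noteq> 0"
    by (rule sum.not_neutral_contains_not_neutral)
  then show "x \<in> h ` Poly_Mapping.keys p" by (auto simp: lookup_single when_def split: if_splits)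
qed

lemma additive_diff:
  fixes f :: "'a::ab_group_add \<Rightarrow> 'b::ab_group_add"
  assumes "\<And>x y. f (x + y) = f x + f y"
  shows "f (x - y) = f x - f y"
  using assms[of "x - y" y] by simp

definition trunc :: "('a \<Rightarrow> nat) \<Rightarrow> nat \<Rightarrow> ('a \<Rightarrow>\<^sub>0 'c::comm_monoid_add) \<Rightarrow> 'a \<Rightarrow>\<^sub>0 'c" where
  "trunc deg d p = (\<Sum>m\<in>{m \<in> Poly_Mapping.keys p. deg m = d}. Poly_Mapping.single m (Poly_Mapping.lookup p m))"

lemma lookup_trunc: "Poly_Mapping.lookup (trunc deg d p) m = (if deg m = d then Poly_Mapping.lookup p m else 0)"
proof -
  have "finite {m \<in> Poly_Mapping.keys p. deg m = d}" by simp
  then show ?thesis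
    by (auto simp: trunc_def lookup_sum lookup_single when_def in_keys_iff sum.delta)
qed

lemma keys_trunc: "Poly_Mapping.keys (trunc deg d p) = {m \<in> Poly_Mapping.keys p. deg m = d}"
  by (auto simp: in_keys_iff lookup_trunc split: if_splits)

lemma trunc_add: "trunc deg d (p + q) = trunc deg d p + trunc deg d q"
  by (rule poly_mapping_eqI) (simp add: lookup_trunc lookup_add)

lemma trunc_zero [simp]: "trunc deg d 0 = 0"
  by (rule poly_mapping_eqI) (simp add: lookup_trunc)

lemma trunc_hom: "\<forall>m\<in>Poly_Mapping.keys p. deg m = e \<Longrightarrow> trunc deg d p = (if d = e then p else 0)"
  by (rule poly_mapping_eqI) (auto simp: lookup_trunc in_keys_iff)

lemma trunc_single: "trunc deg d (Poly_Mapping.single m c) = (if deg m = d then Poly_Mapping.single m c else 0)"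
  by (rule poly_mapping_eqI) (auto simp: lookup_trunc lookup_single when_def)

text \<open>Applied to multiplication by a single term, where \<open>e\<close> is its degree, and to
  \<open>iota_at k\<close> with \<open>e = 0\<close>.\<close>

lemma trunc_shift:
  assumes add: "\<And>x y. T (x + y) = T x + T y" "T 0 = 0"
    and deg: "\<And>m c m'. m' \<in> Poly_Mapping.keys (T (Poly_Mapping.single m c)) \<Longrightarrow> deg' m' = deg m + e"
  shows "trunc deg' d (T p) = (if e \<le> d then T (trunc deg (d - e) p) else 0)"
proof (induction p rule: pm_induct)
  case (single m)
  show ?case
    using trunc_hom[of "T (Poly_Mapping.single m (Poly_Mapping.lookup p m))" deg' "deg m + e" d] deg
    by (auto simp: trunc_single add(2))
qed (simp_all add: add trunc_add)

lemma trunc_induct [case_names trunc zero add]: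
  assumes "\<And>d. P (trunc deg d p)" and "P 0" and "\<And>x y. P x \<Longrightarrow> P y \<Longrightarrow> P (x + y)"
  shows "P p"
proof -
  have fin: "finite D \<Longrightarrow> P (\<Sum>d\<in>D. trunc deg d p)" for D
    by (induction D rule: finite_induct) (auto intro: assms)
  have "p = (\<Sum>d\<in>deg ` Poly_Mapping.keys p. trunc deg d p)"
    by (rule poly_mapping_eqI) (auto simp: lookup_sum lookup_trunc in_keys_iff sum.delta')
  then show ?thesis using fin[of "deg ` Poly_Mapping.keys p"] by simp
qed

section \<open>Rings presented by graded rings of polynomials\<close>

lemma (in ring) ideal_criterion:
  assumes "X \<subseteq> carrier R" "\<zero> \<in> X" "\<And>x y. x \<in> X \<Longrightarrow> y \<in> X \<Longrightarrow> x \<oplus> y \<in> X"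
    and "\<And>x a. x \<in> X \<Longrightarrow> a \<in> carrier R \<Longrightarrow> a \<otimes> x \<in> X"
    and "\<And>x a. x \<in> X \<Longrightarrow> a \<in> carrier R \<Longrightarrow> x \<otimes> a \<in> X"
  shows "ideal X R"
proof (rule idealI)
  show "subgroup X (add_monoid R)"
  proof (rule add.subgroupI)
    fix a assume a: "a \<in> X"
    then have "\<ominus> a = \<ominus> \<one> \<otimes> a" using assms(1) by (auto simp: l_minus)
    then show "\<ominus> a \<in> X" using assms(4)[OF a, of "\<ominus> \<one>"] by simp
  qed (use assms in auto)
qed (use assms ring_axioms in auto)

text \<open>The induced maps on the quotients are defined through \<open>SOME\<close>
  representative; this is the entry point for showing them well defined.\<close>

lemma (in ideal) coset_choice:
  assumes "x \<in> carrier R"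
  shows "(SOME y. y \<in> I +> x) \<in> carrier R" "I +> (SOME y. y \<in> I +> x) = I +> x"
proof -
  have "x \<in> I +> x" using assms by (rule a_rcos_self)
  then have s: "(SOME y. y \<in> I +> x) \<in> I +> x" by (rule someI)
  then show c: "(SOME y. y \<in> I +> x) \<in> carrier R"
    using a_r_coset_subset_G[OF a_subset assms] by blast
  show "I +> (SOME y. y \<in> I +> x) = I +> x"
    using a_repr_independence'[OF s assms] by simp
qed

text \<open>Covers both \<open>F \<rightarrow> A\<close> and \<open>P \<rightarrow> S\<close>.
  \<open>pi_trunc\<close> says that the kernel is homogeneous. \<open>deg_zero\<close> and
  \<open>mult_m0\<close> identify degree 0 of \<open>X\<close> with the field.\<close>

locale graded_presentation = X: ring X + B: ring B
  for X :: "('m \<Rightarrow>\<^sub>0 'k::field) ring" and B :: "('b, 'c) ring_scheme" +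
  fixes \<pi> :: "('m \<Rightarrow>\<^sub>0 'k) \<Rightarrow> 'b" and Mon :: "'m set" and deg :: "'m \<Rightarrow> nat" and m0 :: 'm
    and H :: "nat \<Rightarrow> 'b \<Rightarrow> bool"
  assumes carrier_X: "carrier X = {p. Poly_Mapping.keys p \<subseteq> Mon}"
    and add_X: "add X = (+)" and zero_X: "zero X = 0" and one_X: "one X = Poly_Mapping.single m0 1"
    and pi_hom: "\<pi> \<in> ring_hom X B" and pi_surj: "\<pi> ` carrier X = carrier B"
    and pi_trunc: "p \<in> carrier X \<Longrightarrow> \<pi> p = \<zero>\<^bsub>B\<^esub> \<Longrightarrow> \<pi> (trunc deg d p) = \<zero>\<^bsub>B\<^esub>"
    and deg_mult: "p \<in> carrier X \<Longrightarrow> q \<in> carrier X \<Longrightarrow> \<forall>m\<in>Poly_Mapping.keys p. deg m = d \<Longrightarrow>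
      \<forall>m\<in>Poly_Mapping.keys q. deg m = e \<Longrightarrow> \<forall>m\<in>Poly_Mapping.keys (p \<otimes>\<^bsub>X\<^esub> q). deg m = d + e"
    and deg_zero: "m \<in> Mon \<Longrightarrow> deg m = 0 \<Longrightarrow> m = m0" and m0: "m0 \<in> Mon"
    and mult_m0: "Poly_Mapping.single m0 a \<otimes>\<^bsub>X\<^esub> Poly_Mapping.single m0 b = Poly_Mapping.single m0 (a * b)"
    and H_iff: "H d x \<longleftrightarrow> (\<exists>p\<in>carrier X. (\<forall>m\<in>Poly_Mapping.keys p. deg m = d) \<and> x = \<pi> p)"
begin

definition comp :: "nat \<Rightarrow> 'b \<Rightarrow> 'b" where
  "comp d x = \<pi> (trunc deg d (SOME p. p \<in> carrier X \<and> \<pi> p = x))"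

lemma pi_closed: "p \<in> carrier X \<Longrightarrow> \<pi> p \<in> carrier B"
  using pi_surj by blast

lemma pi_obtain:
  assumes "x \<in> carrier B"
  obtains p where "p \<in> carrier X" "x = \<pi> p"
  using assms unfolding pi_surj[symmetric] by blast

lemma pi_add: "p \<in> carrier X \<Longrightarrow> q \<in> carrier X \<Longrightarrow> \<pi> (p + q) = \<pi> p \<oplus>\<^bsub>B\<^esub> \<pi> q"
  using ring_hom_add[OF pi_hom, of p q] by (simp add: add_X)

lemma pi_zero: "\<pi> 0 = \<zero>\<^bsub>B\<^esub>"
  using ring_hom_zero[OF pi_hom X.ring_axioms B.ring_axioms] by (simp add: zero_X)

lemma X_add: "p \<in> carrier X \<Longrightarrow> q \<in> carrier X \<Longrightarrow> p + q \<in> carrier X"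
  using X.add.m_closed[of p q] by (simp add: add_X)

lemma X_uminus: "p \<in> carrier X \<Longrightarrow> - p \<in> carrier X"
  by (auto simp: carrier_X in_keys_iff)

lemma X_trunc: "p \<in> carrier X \<Longrightarrow> trunc deg d p \<in> carrier X"
  by (auto simp: carrier_X keys_trunc)

text \<open>Two representatives differ by an element of the kernel, whose components lie in the
  kernel as well.\<close>

lemma comp_pi:
  assumes p: "p \<in> carrier X"
  shows "comp d (\<pi> p) = \<pi> (trunc deg d p)"
proof -
  define p' where "p' = (SOME q. q \<in> carrier X \<and> \<pi> q = \<pi> p)"
  have p': "p' \<in> carrier X" "\<pi> p' = \<pi> p"
    using someI[of "\<lambda>q. q \<in> carrier X \<and> \<pi> q = \<pi> p" p] p by (auto simp: p'_def)
  define z where "z = p' - p"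
  have z: "z \<in> carrier X" using X_add[OF p'(1) X_uminus[OF p]] by (simp add: z_def)
  have p'z: "p' = z + p" by (simp add: z_def)
  have "\<pi> z \<oplus>\<^bsub>B\<^esub> \<pi> p = \<pi> p" using p'(2) pi_add[OF z p] p'z by simp
  then have "\<pi> z = \<zero>\<^bsub>B\<^esub>" using pi_closed z p by simp
  then have "\<pi> (trunc deg d p') = \<pi> (trunc deg d p)"
    unfolding p'z using pi_trunc[OF z] p z by (simp add: trunc_add pi_add X_trunc pi_closed)
  then show ?thesis by (simp add: comp_def p'_def)
qed

lemma pi_H: "p \<in> carrier X \<Longrightarrow> \<forall>m\<in>Poly_Mapping.keys p. deg m = d \<Longrightarrow> H d (\<pi> p)"
  using H_iff by blast

lemma H_obtain:
  assumes "H d x"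
  obtains p where "p \<in> carrier X" "\<forall>m\<in>Poly_Mapping.keys p. deg m = d" "x = \<pi> p"
  using assms unfolding H_iff by auto

sublocale graded_ring B H comp
proof unfold_locales
  show "H d x \<Longrightarrow> x \<in> carrier B" for d x using pi_closed by (auto simp: H_iff)
  show "H d (comp d x)" if x: "x \<in> carrier B" for d x
  proof -
    obtain p where p: "p \<in> carrier X" "x = \<pi> p" using x by (rule pi_obtain)
    then show ?thesis by (auto simp: comp_pi X_trunc keys_trunc intro!: pi_H)
  qed
  show "comp d (x \<oplus>\<^bsub>B\<^esub> y) = comp d x \<oplus>\<^bsub>B\<^esub> comp d y" if x: "x \<in> carrier B" and y: "y \<in> carrier B" for d x y
  proof -
    obtain p where "p \<in> carrier X" "x = \<pi> p" using x by (rule pi_obtain)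
    moreover obtain q where "q \<in> carrier X" "y = \<pi> q" using y by (rule pi_obtain)
    ultimately show ?thesis by (simp add: pi_add[symmetric] comp_pi X_add X_trunc trunc_add)
  qed
  show "comp d x = (if d = e then x else \<zero>\<^bsub>B\<^esub>)" if h: "H e x" for d e x
  proof -
    obtain p where "p \<in> carrier X" "\<forall>m\<in>Poly_Mapping.keys p. deg m = e" "x = \<pi> p"
      using h by (rule H_obtain)
    then show ?thesis by (simp add: comp_pi trunc_hom[of p deg e] pi_zero)
  qed
  show "H (d + e) (x \<otimes>\<^bsub>B\<^esub> y)" if x: "H d x" and y: "H e y" for d e x y
  proof -
    obtain p where p: "p \<in> carrier X" "\<forall>m\<in>Poly_Mapping.keys p. deg m = d" "x = \<pi> p"
      using x by (rule H_obtain)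
    obtain q where q: "q \<in> carrier X" "\<forall>m\<in>Poly_Mapping.keys q. deg m = e" "y = \<pi> q"
      using y by (rule H_obtain)
    have "x \<otimes>\<^bsub>B\<^esub> y = \<pi> (p \<otimes>\<^bsub>X\<^esub> q)" using p q ring_hom_mult[OF pi_hom] by simp
    then show ?thesis using pi_H[OF X.m_closed[OF p(1) q(1)]] deg_mult[OF p(1) q(1) p(2) q(2)] by simp
  qed
  show "\<exists>y\<in>carrier B. x \<otimes>\<^bsub>B\<^esub> y = \<one>\<^bsub>B\<^esub>" if x: "H 0 x" "x \<noteq> \<zero>\<^bsub>B\<^esub>" for x
  proof -
    obtain p where p: "p \<in> carrier X" "\<forall>m\<in>Poly_Mapping.keys p. deg m = 0" "x = \<pi> p"
      using x(1) by (rule H_obtain)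
    \<comment> \<open>A representative of degree 0 is a scalar, and it is nonzero because its image
      is.\<close>
    define c where "c = Poly_Mapping.lookup p m0"
    have "Poly_Mapping.keys p \<subseteq> {m0}" using p deg_zero by (auto simp: carrier_X)
    then have pc: "p = Poly_Mapping.single m0 c"
      by (intro poly_mapping_eqI) (auto simp: c_def lookup_single when_def in_keys_iff)
    then have "c \<noteq> 0" using x(2) p(3) pi_zero by auto
    have i: "Poly_Mapping.single m0 (inverse c) \<in> carrier X" using m0 by (simp add: carrier_X)
    have "x \<otimes>\<^bsub>B\<^esub> \<pi> (Poly_Mapping.single m0 (inverse c)) = \<pi> (p \<otimes>\<^bsub>X\<^esub> Poly_Mapping.single m0 (inverse c))"
      using ring_hom_mult[OF pi_hom p(1) i] p(3) by simp
    also have "\<dots> = \<pi> \<one>\<^bsub>X\<^esub>" using \<open>c \<noteq> 0\<close> by (simp add: pc mult_m0 one_X)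
    finally show ?thesis using pi_closed[OF i] ring_hom_one[OF pi_hom] by auto
  qed
  show "P x" if x: "x \<in> carrier B" and add: "\<And>x y. x \<in> carrier B \<Longrightarrow> y \<in> carrier B \<Longrightarrow> P x \<Longrightarrow> P y \<Longrightarrow> P (x \<oplus>\<^bsub>B\<^esub> y)"
    and hom: "\<And>d x. H d x \<Longrightarrow> P x" for x P
  proof -
    obtain p where p: "p \<in> carrier X" "x = \<pi> p" using x by (rule pi_obtain)
    have "p \<in> carrier X \<and> P (\<pi> p)"
    proof (induction p rule: trunc_induct[of _ deg])
      case (trunc d)
      show ?case using X_trunc[OF p(1)] by (auto intro!: hom pi_H simp: keys_trunc)
    next
      case zero
      show ?case using X.zero_closed by (auto intro!: hom[of 0] pi_H simp: zero_X)
    next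
      case (add x y)
      then show ?case by (auto simp: X_add pi_add pi_closed intro!: that(2))
    qed
    then show ?thesis using p by simp
  qed
qed

end

section \<open>Words and multilinear monomials\<close>

text \<open>The word written on the places \<open>k + 1, k + 2, ...\<close>, that is, the image of
  the word under \<open>\<sigma>\<^sup>k \<circ> \<iota>\<close>. Recursion on the word, with moving
  \<open>k\<close>, suits the comparisons of prefixes below.\<close>

fun mon_at :: "nat \<Rightarrow> nat list \<Rightarrow> (nat \<times> nat) \<Rightarrow>\<^sub>0 nat" where
  "mon_at k [] = 0"
| "mon_at k (x # w) = Poly_Mapping.single (x, Suc k) 1 + mon_at (Suc k) w"

definition pdeg :: "('a \<Rightarrow>\<^sub>0 nat) \<Rightarrow> nat" where
  "pdeg m = (\<Sum>v\<in>Poly_Mapping.keys m. Poly_Mapping.lookup m v)"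

lemma pdeg_zero [simp]: "pdeg 0 = 0"
  by (simp add: pdeg_def)

lemma pdeg_single [simp]: "pdeg (Poly_Mapping.single v c) = c"
  by (simp add: pdeg_def)

lemma pdeg_add: "pdeg (a + b) = pdeg a + pdeg b"
  unfolding pdeg_def by (rule setsum_keys_plus_distrib) auto

lemma pdeg_eq_zero: "pdeg m = 0 \<Longrightarrow> m = 0"
  by (auto simp: pdeg_def in_keys_iff intro!: poly_mapping_eqI)

lemma homP_iff: "homP d p \<longleftrightarrow> (\<forall>m\<in>Poly_Mapping.keys p. pdeg m = d)"
  by (simp add: homP_def pdeg_def)

lemma keys_plus_nat: "Poly_Mapping.keys (a + b :: 'a \<Rightarrow>\<^sub>0 nat) = Poly_Mapping.keys a \<union> Poly_Mapping.keys b"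
  by (auto simp: in_keys_iff lookup_add)

lemma pdeg_mon_at [simp]: "pdeg (mon_at k w) = length w"
  by (induction w arbitrary: k) (auto simp: pdeg_add)

lemma keys_mon_at: "fst ` Poly_Mapping.keys (mon_at k w) = set w"
  by (induction w arbitrary: k) (auto simp: keys_plus_nat image_Un)

lemma snd_keys_mon_at: "v \<in> Poly_Mapping.keys (mon_at k w) \<Longrightarrow> k < snd v"
  by (induction w arbitrary: k) (auto simp: keys_plus_nat dest: Suc_lessD)

lemma lookup_mon_at_low: "j \<le> k \<Longrightarrow> Poly_Mapping.lookup (mon_at k w) (i, j) = 0"
  using snd_keys_mon_at[of "(i, j)" k w] by (fastforce simp: in_keys_iff)

lemma mon_at_append: "mon_at k (u @ v) = mon_at k u + mon_at (k + length u) v"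
  by (induction u arbitrary: k) (auto simp: add.assoc)

lemma mon_of_word_eq: "mon_of_word w = mon_at 0 w"
proof -
  have "(\<Sum>j<length w. Poly_Mapping.single (w ! j, k + j + 1) 1) = mon_at k w" for k
  proof (induction w arbitrary: k)
    case (Cons x w)
    show ?case using Cons[of "Suc k"] by (simp add: sum.lessThan_Suc_shift del: sum.lessThan_Suc)
  qed simp
  from this[of 0] show ?thesis by (simp add: mon_of_word_def)
qed

lemma sigma_mon_push: "sigma_mon = push (\<lambda>v. (fst v, snd v + 1))"
  by (rule ext) (simp add: sigma_mon_def push_def)

lemma sigma_mon_mon_at: "sigma_mon (mon_at k w) = mon_at (Suc k) w"
  unfolding sigma_mon_push by (induction w arbitrary: k) (auto simp: push_add)

lemma lookup_split:
  fixes m :: "'a \<Rightarrow>\<^sub>0 nat"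
  assumes "Poly_Mapping.lookup m v \<ge> 1"
  obtains m' where "m = Poly_Mapping.single v 1 + m'"
proof
  show "m = Poly_Mapping.single v 1 + (m - Poly_Mapping.single v 1)"
    by (rule poly_mapping_eqI) (use assms in \<open>auto simp: lookup_add lookup_minus lookup_single when_def\<close>)
qed

text \<open>Place \<open>k + 1\<close> carries just one variable of \<open>mon_at k u\<close>, so
  the first letters agree and can be cancelled. On monomials, this is the rule for
  \<open>\<rho>\<close> on a product with an embedded left factor.\<close>

lemma mon_at_prefix:
  "mon_at k w + m = mon_at k u \<Longrightarrow> \<exists>v. u = w @ v \<and> m = mon_at (k + length w) v"
proof (induction w arbitrary: k u)
  case (Cons x w)
  have ge: "Poly_Mapping.lookup (mon_at k u) (x, Suc k) \<ge> 1"
    unfolding Cons.prems[symmetric] by (simp add: lookup_add)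
  then obtain y u' where u: "u = y # u'" by (cases u) auto
  have "y = x" using ge
    by (auto simp: u lookup_add lookup_mon_at_low lookup_single when_def split: if_splits)
  then have "mon_at (Suc k) w + m = mon_at (Suc k) u'"
    using Cons.prems by (simp add: u add.assoc)
  from Cons.IH[OF this] show ?case using u \<open>y = x\<close> by auto
qed simp

lemma inj_mon_at: "inj (mon_at k)"
proof (rule injI)
  fix w u assume "mon_at k w = mon_at k u"
  then obtain v where v: "u = w @ v" "0 = mon_at (k + length w) v"
    using mon_at_prefix[of k w 0 u] by auto
  then have "length v = 0" by (metis pdeg_mon_at pdeg_zero)
  then show "w = u" using v by simp
qed

text \<open>By induction on \<open>u\<close>: if \<open>j = k\<close> the word is a prefix; if
  \<open>k < j\<close> the first letter of \<open>u\<close> must come from \<open>m\<close>;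
  \<open>j < k\<close> is impossible, as \<open>mon_at k u\<close> has no variable at place
  \<open>j + 1\<close>. The empty word is excluded because it does not determine
  \<open>j\<close>.\<close>

lemma mon_at_infix:
  "mon_at j w + m = mon_at k u \<Longrightarrow> w \<noteq> [] \<Longrightarrow>
    \<exists>u1 u2. u = u1 @ w @ u2 \<and> j = k + length u1 \<and> m = mon_at k u1 + mon_at (j + length w) u2"
proof (induction u arbitrary: k m)
  case Nil
  then have "pdeg (mon_at j w + m) = 0" by simp
  then show ?case using Nil.prems(2) by (simp add: pdeg_add)
next
  case (Cons y u)
  consider "j = k" | "k < j" | "j < k" by linarith
  then show ?case
  proof cases
    case 1
    then obtain v where "y # u = w @ v" "m = mon_at (k + length w) v"
      using mon_at_prefix[of k w m "y # u"] Cons.prems(1) by blast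
    then show ?thesis using 1 by (intro exI[of _ "[]"] exI[of _ v]) simp
  next
    case 2
    have "Poly_Mapping.lookup (mon_at j w + m) (y, Suc k) \<ge> 1"
      unfolding Cons.prems(1) by (simp add: lookup_add)
    then have "Poly_Mapping.lookup m (y, Suc k) \<ge> 1"
      using lookup_mon_at_low[of "Suc k" j w y] 2 by (simp add: lookup_add)
    then obtain m' where m': "m = Poly_Mapping.single (y, Suc k) 1 + m'" by (rule lookup_split)
    have "Poly_Mapping.single (y, Suc k) 1 + (mon_at j w + m') = Poly_Mapping.single (y, Suc k) 1 + mon_at (Suc k) u"
      using Cons.prems(1) by (simp add: m' add_ac)
    then have "mon_at j w + m' = mon_at (Suc k) u" by simp
    from Cons.IH[OF this Cons.prems(2)] obtain u1 u2 where
      "u = u1 @ w @ u2" "j = Suc k + length u1" "m' = mon_at (Suc k) u1 + mon_at (j + length w) u2" by blast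
    then show ?thesis by (intro exI[of _ "y # u1"] exI[of _ u2]) (auto simp: m' add_ac)
  next
    case 3
    obtain x w' where w: "w = x # w'" using Cons.prems(2) by (cases w) auto
    have "Poly_Mapping.lookup (mon_at k (y # u)) (x, Suc j) \<ge> 1"
      unfolding Cons.prems(1)[symmetric] by (simp add: w lookup_add)
    then show ?thesis using lookup_mon_at_low[of "Suc j" k "y # u" x] 3 by simp
  qed
qed

text \<open>A place carries at most one variable, and with exponent 1, which rules out the squares
  \<open>i = l\<close> as well. The cofactor \<open>m\<close> is arbitrary, so no multiple of a
  generator of \<open>Q\<close> is seen by the retractions.\<close>

lemma mon_at_no_collision:
  "mon_at k w \<noteq> m + (Poly_Mapping.single (i, j) 1 + Poly_Mapping.single (l, j) 1)"
proof (induction w arbitrary: k m)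
  case Nil
  show ?case
  proof
    assume "mon_at k [] = m + (Poly_Mapping.single (i, j) 1 + Poly_Mapping.single (l, j) 1)"
    then have "pdeg (m + (Poly_Mapping.single (i, j) 1 + Poly_Mapping.single (l, j) (1::nat))) = 0" by simp
    then show False by (simp add: pdeg_add)
  qed
next
  case (Cons x w)
  let ?q = "Poly_Mapping.single (i, j) (1::nat) + Poly_Mapping.single (l, j) 1"
  show ?case
  proof
    assume eq: "mon_at k (x # w) = m + ?q"
    show False
    proof (cases "j = Suc k")
      case True
      \<comment> \<open>Reading off the exponents at \<open>(i, j)\<close> and \<open>(l, j)\<close>
        forces \<open>i = x = l\<close>, and then the exponent would be at least 2.\<close>
      have "Poly_Mapping.lookup (mon_at k (x # w)) (i', j) = (if i' = x then 1 else 0)" for i'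
        using True by (simp add: lookup_add lookup_single lookup_mon_at_low when_def)
      note this[unfolded eq]
      from this[of i] this[of l] show False
        by (auto simp: lookup_add lookup_single when_def split: if_splits)
    next
      case False
      have "Poly_Mapping.lookup (m + ?q) (x, Suc k) \<ge> 1"
        unfolding eq[symmetric] by (simp add: lookup_add)
      then have "Poly_Mapping.lookup m (x, Suc k) \<ge> 1"
        using False by (simp add: lookup_add lookup_single when_def split: if_splits)
      then obtain m' where m': "m = Poly_Mapping.single (x, Suc k) 1 + m'" by (rule lookup_split)
      have "Poly_Mapping.single (x, Suc k) 1 + mon_at (Suc k) w = Poly_Mapping.single (x, Suc k) 1 + (m' + ?q)"
        using eq by (simp add: m' add.assoc)
      then show False using Cons.IH[of "Suc k" m'] by simp
    qed
  qed
qed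

section \<open>Multilinear embeddings and their retractions\<close>

lemma push_mult:
  fixes p q :: "'a::monoid_add \<Rightarrow>\<^sub>0 'c::semiring_0" and h :: "'a \<Rightarrow> 'b::monoid_add"
  assumes "\<And>a b. h (a + b) = h a + h b"
  shows "push h (p * q) = push h p * push h q"
proof (induction p rule: pm_induct)
  case (single m)
  show ?case
    by (induction q rule: pm_induct) (simp_all add: push_add mult_single assms distrib_left)
qed (simp_all add: push_add distrib_right)

lemma sigmaP_push: "sigmaP = push sigma_mon"
  by (rule ext) (simp add: sigmaP_def push_def)

lemma sigmaP_mult: "sigmaP (p * q) = sigmaP p * sigmaP q"
  unfolding sigmaP_push by (rule push_mult) (simp add: sigma_mon_push push_add)

definition iota_at :: "nat \<Rightarrow> 'k::field ncpoly \<Rightarrow> 'k cpoly" where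
  "iota_at k = push (mon_at k)"

lemma iotaP_eq: "iotaP = iota_at 0"
  by (rule ext) (simp add: iotaP_def iota_at_def push_def mon_of_word_eq)

lemma sigmaP_iota_at: "sigmaP (iota_at k f) = iota_at (Suc k) f"
  by (simp add: sigmaP_push iota_at_def push_push comp_def sigma_mon_mon_at)

text \<open>\<open>map_key\<close> precomposes the coefficient function with
  \<open>mon_at k\<close>; injectivity of \<open>mon_at k\<close> keeps the support finite.\<close>

definition rho :: "nat \<Rightarrow> 'k::field cpoly \<Rightarrow> 'k ncpoly" where
  "rho k = Poly_Mapping.map_key (mon_at k)"

lemma lookup_rho: "Poly_Mapping.lookup (rho k p) w = Poly_Mapping.lookup p (mon_at k w)"
  using inj_mon_at by (simp add: rho_def map_key.rep_eq)

lemma rho_add: "rho k (p + q) = rho k p + rho k q"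
  by (rule poly_mapping_eqI) (simp add: lookup_rho lookup_add)

lemma rho_zero [simp]: "rho k 0 = 0"
  by (rule poly_mapping_eqI) (simp add: lookup_rho)

lemma keys_rho: "w \<in> Poly_Mapping.keys (rho k p) \<longleftrightarrow> mon_at k w \<in> Poly_Mapping.keys p"
  by (simp add: in_keys_iff lookup_rho)

lemma rho_single_mon_at [simp]: "rho k (Poly_Mapping.single (mon_at k w) c) = Poly_Mapping.single w c"
  by (rule poly_mapping_eqI) (auto simp: lookup_rho lookup_single when_def dest: injD[OF inj_mon_at])

lemma rho_single_other: "(\<And>w. m \<noteq> mon_at k w) \<Longrightarrow> rho k (Poly_Mapping.single m c) = 0"
  by (rule poly_mapping_eqI) (auto simp: lookup_rho lookup_single when_def)

lemma iota_at_add: "iota_at k (f + g) = iota_at k f + iota_at k g"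
  and iota_at_zero [simp]: "iota_at k 0 = 0"
  and iota_at_single [simp]: "iota_at k (Poly_Mapping.single w c) = Poly_Mapping.single (mon_at k w) c"
  by (simp_all add: iota_at_def push_add)

lemma rho_iota_at: "rho k (iota_at k f) = f"
  by (induction f rule: pm_induct) (simp_all add: iota_at_add rho_add)

lemma nc_mult_superset:
  assumes "finite K" "finite L" "Poly_Mapping.keys f \<subseteq> K" "Poly_Mapping.keys g \<subseteq> L"
  shows "nc_mult f g = (\<Sum>u\<in>K. \<Sum>v\<in>L.
    Poly_Mapping.single (u @ v) (Poly_Mapping.lookup f u * Poly_Mapping.lookup g v))"
proof -
  have "(\<Sum>v\<in>Poly_Mapping.keys g. Poly_Mapping.single (u @ v) (Poly_Mapping.lookup f u * Poly_Mapping.lookup g v))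
    = (\<Sum>v\<in>L. Poly_Mapping.single (u @ v) (Poly_Mapping.lookup f u * Poly_Mapping.lookup g v))" for u
    by (rule sum.mono_neutral_left) (use assms in \<open>auto simp: in_keys_iff\<close>)
  then show ?thesis unfolding nc_mult_def
    by (simp, intro sum.mono_neutral_left) (use assms in \<open>auto simp: in_keys_iff\<close>)
qed

lemma nc_mult_add_left: "nc_mult (f + f') g = nc_mult f g + nc_mult f' g"
proof -
  let ?K = "Poly_Mapping.keys f \<union> Poly_Mapping.keys f'" and ?L = "Poly_Mapping.keys g"
  have "Poly_Mapping.keys (f + f') \<subseteq> ?K" by (rule keys_add)
  then show ?thesis
    by (simp add: nc_mult_superset[of ?K ?L] lookup_add distrib_right single_add sum.distrib)
qed

lemma nc_mult_add_right: "nc_mult f (g + g') = nc_mult f g + nc_mult f g'"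
proof -
  let ?K = "Poly_Mapping.keys f" and ?L = "Poly_Mapping.keys g \<union> Poly_Mapping.keys g'"
  have "Poly_Mapping.keys (g + g') \<subseteq> ?L" by (rule keys_add)
  then show ?thesis
    by (simp add: nc_mult_superset[of ?K ?L] lookup_add distrib_left single_add sum.distrib)
qed

lemma nc_mult_zero [simp]: "nc_mult 0 g = 0" "nc_mult f 0 = 0"
  by (simp_all add: nc_mult_def)

lemma nc_mult_single [simp]:
  "nc_mult (Poly_Mapping.single u a) (Poly_Mapping.single v b) = Poly_Mapping.single (u @ v) (a * b)"
  by (cases "a = 0"; cases "b = 0") (simp_all add: nc_mult_def)

lemma keys_nc_mult:
  assumes "w \<in> Poly_Mapping.keys (nc_mult f g)"
  obtains u v where "u \<in> Poly_Mapping.keys f" "v \<in> Poly_Mapping.keys g" "w = u @ v"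
proof -
  have "Poly_Mapping.keys (nc_mult f g) \<subseteq> {u @ v |u v. u \<in> Poly_Mapping.keys f \<and> v \<in> Poly_Mapping.keys g}"
    unfolding nc_mult_def
    by (intro order_trans[OF keys_sum] UN_least) (auto split: if_splits)
  then show thesis using assms that by blast
qed

text \<open>All words of \<open>f\<close> have length \<open>e\<close>, so whatever completes one of
  them to a word starts at place \<open>k + e + 1\<close>. Terms of \<open>p\<close> that complete
  none vanish on both sides.\<close>

lemma rho_iota_at_mult:
  assumes "homF e f"
  shows "rho k (iota_at k f * p) = nc_mult f (rho (k + e) p)"
proof (induction f rule: pm_induct)
  case (single w)
  then have w: "length w = e" using assms by (simp add: homF_def)
  let ?c = "Poly_Mapping.lookup f w"
  show ?case
  proof (induction p rule: pm_induct)
    case (single m)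
    let ?b = "Poly_Mapping.lookup p m"
    show ?case
    proof (cases "\<exists>u. mon_at k w + m = mon_at k u")
      case True
      then obtain v where v: "m = mon_at (k + length w) v" using mon_at_prefix by blast
      show ?thesis using rho_single_mon_at[of k "w @ v" "?c * ?b"] w
        by (simp add: v mult_single mon_at_append)
    next
      case False
      have "m \<noteq> mon_at (k + e) v" for v
        using False mon_at_append[of k w v] w by metis
      then show ?thesis using False by (simp add: mult_single rho_single_other)
    qed
  qed (simp_all add: distrib_left rho_add nc_mult_add_right)
next
  case (add x y)
  show ?case by (simp add: add iota_at_add distrib_right rho_add nc_mult_add_left)
qed simp_all

lemma iota_at_mult:
  assumes "homF e f"
  shows "iota_at k (nc_mult f g) = iota_at k f * iota_at (k + e) g"
proof (induction f rule: pm_induct)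
  case (single w)
  then have w: "length w = e" using assms by (simp add: homF_def)
  show ?case
    by (induction g rule: pm_induct)
      (simp_all add: distrib_left iota_at_add nc_mult_add_right mult_single mon_at_append w)
qed (simp_all add: iota_at_add distrib_right nc_mult_add_left)

section \<open>The rings of the letterplace correspondence\<close>

definition MonP :: "nat \<Rightarrow> ((nat \<times> nat) \<Rightarrow>\<^sub>0 nat) set" where
  "MonP n = {m. \<forall>v\<in>Poly_Mapping.keys m. fst v \<in> {1..n} \<and> snd v \<ge> 1}"

lemma MonP_add: "a \<in> MonP n \<Longrightarrow> b \<in> MonP n \<Longrightarrow> a + b \<in> MonP n"
  and MonP_zero: "0 \<in> MonP n"
  by (auto simp: MonP_def keys_plus_nat)

lemma MonP_addD: "a + b \<in> MonP n \<Longrightarrow> a \<in> MonP n \<and> b \<in> MonP n"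
  by (auto simp: MonP_def keys_plus_nat)

lemma MonP_mon_at: "mon_at k w \<in> MonP n \<longleftrightarrow> set w \<subseteq> {1..n}"
proof -
  have "\<forall>v\<in>Poly_Mapping.keys (mon_at k w). snd v \<ge> 1"
    using snd_keys_mon_at by fastforce
  then show ?thesis unfolding keys_mon_at[of k w, symmetric] MonP_def image_subset_iff by blast
qed

lemma MonP_sigma: "m \<in> MonP n \<Longrightarrow> sigma_mon m \<in> MonP n"
  using keys_push[of "\<lambda>v. (fst v, snd v + 1)" m] by (fastforce simp: MonP_def sigma_mon_push)

lemma carrier_P: "carrier (Pring n) = {p. Poly_Mapping.keys p \<subseteq> MonP n}"
  by (auto simp: Pring_def MonP_def)

lemma P_simps [simp]:
  "add (Pring n) = (+)" "mult (Pring n) = (*)" "zero (Pring n) = 0" "one (Pring n) = 1"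
  by (simp_all add: Pring_def)

lemma P_add: "p \<in> carrier (Pring n) \<Longrightarrow> q \<in> carrier (Pring n) \<Longrightarrow> p + q \<in> carrier (Pring n)"
  using keys_add[of p q] by (auto simp: carrier_P)

lemma P_uminus: "p \<in> carrier (Pring n) \<Longrightarrow> - p \<in> carrier (Pring n)"
  by (auto simp: carrier_P in_keys_iff)

lemma P_diff: "p \<in> carrier (Pring n) \<Longrightarrow> q \<in> carrier (Pring n) \<Longrightarrow> p - q \<in> carrier (Pring n)"
  using P_add[OF _ P_uminus, of p n q] by simp

lemma P_mult: "p \<in> carrier (Pring n) \<Longrightarrow> q \<in> carrier (Pring n) \<Longrightarrow> p * q \<in> carrier (Pring n)"
  using keys_mult[of p q] MonP_add by (fastforce simp: carrier_P)

lemma P_single: "m \<in> MonP n \<Longrightarrow> Poly_Mapping.single m c \<in> carrier (Pring n)"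
  by (simp add: carrier_P)

lemma P_cring: "cring (Pring n :: ('k::field cpoly) ring)"
proof (rule cringI)
  show "abelian_group (Pring n :: ('k cpoly) ring)"
  proof (rule abelian_groupI)
    fix x :: "'k cpoly" assume "x \<in> carrier (Pring n)"
    then show "\<exists>y\<in>carrier (Pring n). y \<oplus>\<^bsub>Pring n\<^esub> x = \<zero>\<^bsub>Pring n\<^esub>"
      using P_uminus by (intro bexI[of _ "- x"]) auto
  qed (auto simp: P_add add_ac, auto simp: carrier_P)
  show "Group.comm_monoid (Pring n :: ('k cpoly) ring)"
    by (rule comm_monoidI) (auto simp: P_mult mult_ac, auto simp: carrier_P MonP_zero)
qed (auto simp: distrib_right)

lemmas P_ring = cring.axioms(1)[OF P_cring]

lemma a_minus_eq_minus:
  fixes R :: "('a::ab_group_add, 'b) ring_scheme"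
  assumes "ring R" "add R = (+)" "zero R = 0" "x \<in> carrier R" "y \<in> carrier R" "- y \<in> carrier R"
  shows "x \<ominus>\<^bsub>R\<^esub> y = x - y"
proof -
  interpret ring R by fact
  have "\<ominus>\<^bsub>R\<^esub> y = - y" using assms by (intro minus_equality) auto
  then show ?thesis by (simp add: a_minus_def assms)
qed

lemma P_minus: "x \<in> carrier (Pring n) \<Longrightarrow> y \<in> carrier (Pring n) \<Longrightarrow> x \<ominus>\<^bsub>Pring n\<^esub> y = x - y"
  using P_ring by (intro a_minus_eq_minus) (auto simp: P_uminus)

lemma carrier_F: "carrier (Fring n) = {f. Poly_Mapping.keys f \<subseteq> {w. set w \<subseteq> {1..n}}}"
  by (auto simp: Fring_def)

lemma F_simps [simp]:
  "add (Fring n) = (+)" "mult (Fring n) = nc_mult" "zero (Fring n) = 0"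
  "one (Fring n) = Poly_Mapping.single [] 1"
  by (simp_all add: Fring_def)

lemma F_uminus: "f \<in> carrier (Fring n) \<Longrightarrow> - f \<in> carrier (Fring n)"
  by (auto simp: carrier_F in_keys_iff)

lemma F_add: "f \<in> carrier (Fring n) \<Longrightarrow> g \<in> carrier (Fring n) \<Longrightarrow> f + g \<in> carrier (Fring n)"
  using keys_add[of f g] by (auto simp: carrier_F)

lemma rho_carrier: "p \<in> carrier (Pring n) \<Longrightarrow> rho k p \<in> carrier (Fring n)"
  unfolding carrier_F carrier_P using keys_rho MonP_mon_at by blast

lemma iota_at_carrier: "f \<in> carrier (Fring n) \<Longrightarrow> iota_at k f \<in> carrier (Pring n)"
  using keys_push[of "mon_at k" f] by (fastforce simp: carrier_F carrier_P iota_at_def MonP_mon_at)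

lemma sigmaP_carrier: "p \<in> carrier (Pring n) \<Longrightarrow> sigmaP p \<in> carrier (Pring n)"
  using keys_push[of sigma_mon p] MonP_sigma[of _ n] by (fastforce simp: carrier_P sigmaP_push)

lemma sigmaP_add: "sigmaP (p + q) = sigmaP p + sigmaP q"
  by (simp add: sigmaP_push push_add)

lemma homF_iota_at: "homF d f \<Longrightarrow> homP d (iota_at k f)"
  using keys_push[of "mon_at k" f] by (fastforce simp: homF_def homP_iff iota_at_def)

lemma homP_rho: "homP d p \<Longrightarrow> homF d (rho k p)"
  by (auto simp: homF_def homP_iff keys_rho) (metis pdeg_mon_at)

lemma homF_trunc: "homF d (trunc length d f)"
  by (simp add: homF_def keys_trunc)

lemma trunc_iota_at: "trunc pdeg d (iota_at k f) = iota_at k (trunc length d f)"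
  by (subst trunc_shift[where deg = length and e = 0]) (auto simp: iota_at_add split: if_splits)

section \<open>The ideal Q, the ring R and its shift\<close>

definition Qgens :: "nat \<Rightarrow> 'k::field cpoly set" where
  "Qgens n = {Poly_Mapping.single (Poly_Mapping.single (i, j) 1 + Poly_Mapping.single (k, j) 1) 1
       | i k j. i \<in> {1..n} \<and> k \<in> {1..n} \<and> j \<ge> 1}"

lemma Qideal_eq: "Qideal n = genideal (Pring n) (Qgens n)"
  by (simp add: Qideal_def Qgens_def)

lemma Qgens_carrier: "Qgens n \<subseteq> carrier (Pring n)"
  by (auto simp: Qgens_def carrier_P MonP_def keys_plus_nat split: if_splits)

lemma sigmaP_Qgens: "g \<in> Qgens n \<Longrightarrow> sigmaP g \<in> Qgens n"
  unfolding Qgens_def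
  by (auto simp: sigmaP_push sigma_mon_push push_add) (metis One_nat_def le_SucI)

lemma ideal_Q: "ideal (Qideal n) (Pring n)"
  unfolding Qideal_eq by (rule ring.genideal_ideal[OF P_ring Qgens_carrier])

lemma Qgens_Q: "Qgens n \<subseteq> Qideal n"
  unfolding Qideal_eq by (rule ring.genideal_self[OF P_ring Qgens_carrier])

lemma Qideal_least: "ideal X (Pring n) \<Longrightarrow> Qgens n \<subseteq> X \<Longrightarrow> Qideal n \<subseteq> X"
  unfolding Qideal_eq by (rule ring.genideal_minimal[OF P_ring])

lemma P_ideal_criterion:
  assumes "X \<subseteq> carrier (Pring n)" "0 \<in> X" "\<And>x y. x \<in> X \<Longrightarrow> y \<in> X \<Longrightarrow> x + y \<in> X"
    and "\<And>x a. x \<in> X \<Longrightarrow> a \<in> carrier (Pring n) \<Longrightarrow> a * x \<in> X"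
  shows "ideal X (Pring n)"
proof (rule ring.ideal_criterion[OF P_ring])
  fix x a assume "x \<in> X" "a \<in> carrier (Pring n :: 'a cpoly ring)"
  then show "x \<otimes>\<^bsub>Pring n\<^esub> a \<in> X" using assms(4)[of x a] by (simp add: mult.commute)
qed (use assms in auto)

lemma P_idealD:
  assumes "ideal X (Pring n)"
  shows "X \<subseteq> carrier (Pring n)" "0 \<in> X" "x \<in> X \<Longrightarrow> y \<in> X \<Longrightarrow> x + y \<in> X"
    "x \<in> X \<Longrightarrow> a \<in> carrier (Pring n) \<Longrightarrow> a * x \<in> X"
proof -
  interpret ideal X "Pring n" by fact
  show "X \<subseteq> carrier (Pring n)" by (rule a_subset)
  show "0 \<in> X" using additive_subgroup.zero_closed[OF is_additive_subgroup] by simp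
  show "x \<in> X \<Longrightarrow> y \<in> X \<Longrightarrow> x + y \<in> X" using additive_subgroup.a_closed[OF is_additive_subgroup] by simp
  show "x \<in> X \<Longrightarrow> a \<in> carrier (Pring n) \<Longrightarrow> a * x \<in> X" using I_l_closed by simp
qed

lemma piQ_eq_iff:
  assumes "p \<in> carrier (Pring n)" "q \<in> carrier (Pring n)"
  shows "piQ n p = piQ n q \<longleftrightarrow> p - q \<in> Qideal n"
  using ring.quotient_eq_iff_same_a_r_cos[OF P_ring ideal_Q assms] P_minus[OF assms]
  by (auto simp: piQ_def)

lemma piQ_hom: "piQ n \<in> ring_hom (Pring n) (Rring n)"
  unfolding piQ_def Rring_def by (rule ideal.rcos_ring_hom[OF ideal_Q])

lemma piQ_surj: "piQ n ` carrier (Pring n) = carrier (Rring n)"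
  by (auto simp: piQ_def Rring_def FactRing_def A_RCOSETS_defs a_r_coset_def)

lemma R_ring: "ring (Rring n)"
  unfolding Rring_def by (rule ideal.quotient_is_ring[OF ideal_Q])

lemma sigmaP_Q: "p \<in> Qideal n \<Longrightarrow> sigmaP p \<in> Qideal n"
proof -
  \<comment> \<open>The preimage of \<open>Q\<close> under the multiplicative map
    \<open>\<sigma>\<close> is an ideal, so only generators have to be checked.\<close>
  let ?X = "{p \<in> carrier (Pring n). sigmaP p \<in> Qideal n}"
  note Q = P_idealD[OF ideal_Q]
  have "ideal ?X (Pring n)"
  proof (rule P_ideal_criterion)
    show "0 \<in> ?X" using Q(2) by (simp add: carrier_P sigmaP_push)
  qed (auto simp: P_add P_mult sigmaP_add sigmaP_mult sigmaP_carrier intro: Q(3,4))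
  moreover have "Qgens n \<subseteq> ?X" using Qgens_carrier sigmaP_Qgens Qgens_Q by blast
  ultimately show "p \<in> Qideal n \<Longrightarrow> sigmaP p \<in> Qideal n" using Qideal_least by blast
qed

lemma sigmaR_piQ:
  assumes "p \<in> carrier (Pring n)"
  shows "sigmaR n (piQ n p) = piQ n (sigmaP p)"
proof -
  define p' where "p' = (SOME y. y \<in> piQ n p)"
  have p': "p' \<in> carrier (Pring n)" "piQ n p' = piQ n p"
    using ideal.coset_choice[OF ideal_Q assms] by (auto simp: p'_def piQ_def)
  then have "sigmaP (p' - p) \<in> Qideal n" using piQ_eq_iff assms sigmaP_Q by blast
  then have "sigmaP p' - sigmaP p \<in> Qideal n"
    by (simp add: additive_diff[of sigmaP, OF sigmaP_add])
  then show ?thesis using piQ_eq_iff[of "sigmaP p'" n "sigmaP p"] p' assms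
    by (simp add: sigmaR_def p'_def[symmetric] sigmaP_carrier)
qed

lemma sigmaR_pow_iotaP:
  assumes "f \<in> carrier (Fring n)"
  shows "(sigmaR n ^^ k) (piQ n (iotaP f)) = piQ n (iota_at k f)"
  by (induction k) (simp_all add: iotaP_eq sigmaR_piQ iota_at_carrier assms sigmaP_iota_at)

section \<open>The graded ideal I and the kernel of P \<rightarrow> S\<close>

locale letterplace =
  fixes n :: nat and I :: "'k::field ncpoly set"
  assumes graded_I: "graded_ideal_F n I"
begin

lemma ideal_I: "ideal I (Fring n)"
  using graded_I by (simp add: graded_ideal_F_def)

lemma ring_F: "ring (Fring n :: 'k ncpoly ring)"
  using ideal_I by (rule ideal.axioms)

lemma F_mult: "f \<in> carrier (Fring n) \<Longrightarrow> g \<in> carrier (Fring n) \<Longrightarrow> nc_mult f g \<in> carrier (Fring n)"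
  for f g :: "'k ncpoly"
  using ring.ring_simprules(5)[OF ring_F, of f g] by simp

lemma I_D:
  shows "I \<subseteq> carrier (Fring n)" "0 \<in> I" "x \<in> I \<Longrightarrow> y \<in> I \<Longrightarrow> x + y \<in> I"
    "x \<in> I \<Longrightarrow> a \<in> carrier (Fring n) \<Longrightarrow> nc_mult a x \<in> I"
    "x \<in> I \<Longrightarrow> a \<in> carrier (Fring n) \<Longrightarrow> nc_mult x a \<in> I"
proof -
  interpret ideal I "Fring n" by (rule ideal_I)
  show "I \<subseteq> carrier (Fring n)" by (rule a_subset)
  show "0 \<in> I" using additive_subgroup.zero_closed[OF is_additive_subgroup] by simp
  show "x \<in> I \<Longrightarrow> y \<in> I \<Longrightarrow> x + y \<in> I" using additive_subgroup.a_closed[OF is_additive_subgroup] by simp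
  show "x \<in> I \<Longrightarrow> a \<in> carrier (Fring n) \<Longrightarrow> nc_mult a x \<in> I" using I_l_closed by simp
  show "x \<in> I \<Longrightarrow> a \<in> carrier (Fring n) \<Longrightarrow> nc_mult x a \<in> I" using I_r_closed by simp
qed

text \<open>Gradedness is given as generation by homogeneous elements. The elements with all
  components in \<open>I\<close> form an ideal containing these generators, hence all of
  \<open>I\<close>.\<close>

lemma trunc_I:
  assumes "f \<in> I"
  shows "trunc length d f \<in> I"
proof -
  let ?X = "{f \<in> carrier (Fring n). \<forall>d. trunc length d f \<in> I}"
  have "ideal ?X (Fring n)"
  proof (rule ring.ideal_criterion[OF ring_F])
    fix f a assume f: "f \<in> ?X" and a: "a \<in> carrier (Fring n :: 'k ncpoly ring)"
    have "trunc length d (nc_mult a f) \<in> I" for d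
    proof (induction a rule: pm_induct)
      case (single u)
      then have "Poly_Mapping.single u (Poly_Mapping.lookup a u) \<in> carrier (Fring n)"
        using a by (auto simp: carrier_F)
      then show ?case
        by (subst trunc_shift[where deg = length and e = "length u"])
          (use f I_D in \<open>auto simp: nc_mult_add_right split: if_splits\<close>)
    qed (simp_all add: I_D nc_mult_add_left trunc_add)
    then show "a \<otimes>\<^bsub>Fring n\<^esub> f \<in> ?X" using f a by (auto simp: F_mult)
    have "trunc length d (nc_mult f a) \<in> I" for d
    proof (induction a rule: pm_induct)
      case (single u)
      then have "Poly_Mapping.single u (Poly_Mapping.lookup a u) \<in> carrier (Fring n)"
        using a by (auto simp: carrier_F)
      then show ?case
        by (subst trunc_shift[where deg = length and e = "length u"
              and T = "\<lambda>f. nc_mult f (Poly_Mapping.single u (Poly_Mapping.lookup a u))"])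
          (use f I_D in \<open>auto simp: nc_mult_add_left split: if_splits\<close>)
    qed (simp_all add: I_D nc_mult_add_right trunc_add)
    then show "f \<otimes>\<^bsub>Fring n\<^esub> a \<in> ?X" using f a by (auto simp: F_mult)
  qed (auto simp: I_D F_add trunc_add, auto simp: carrier_F)
  moreover have "{f \<in> I. \<exists>d. homF d f} \<subseteq> ?X"
  proof
    fix f assume "f \<in> {f \<in> I. \<exists>d. homF d f}"
    then obtain e where f: "f \<in> I" "homF e f" by blast
    then show "f \<in> ?X" using trunc_hom[of f length e] I_D(1,2) by (auto simp: homF_def)
  qed
  ultimately have "I \<subseteq> ?X"
    using graded_I ring.genideal_minimal[OF ring_F] unfolding graded_ideal_F_def by blast
  then show ?thesis using assms by blast
qed

text \<open>The kernel of \<open>P \<rightarrow> S\<close>. It replaces computations with cosets of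
  cosets by computations with polynomials.\<close>

definition Jhat :: "'k cpoly set" where
  "Jhat = {p \<in> carrier (Pring n). piS n I (piQ n p) = \<zero>\<^bsub>Sring n I\<^esub>}"

definition Jgens :: "'k cpoly set" where
  "Jgens = {iota_at k f | k f. f \<in> I}"

lemma Jgens_carrier: "Jgens \<subseteq> carrier (Pring n)"
  using I_D by (auto simp: Jgens_def intro!: iota_at_carrier)

lemma Jideal_eq: "Jideal n I = genideal (Rring n) (piQ n ` Jgens)"
proof -
  have "{(sigmaR n ^^ k) (piQ n (iotaP f)) | k f. f \<in> I} = {piQ n (iota_at k f) | k f. f \<in> I}"
    using sigmaR_pow_iotaP[of _ n] I_D(1) by (metis (no_types, lifting) subsetD)
  moreover have "{piQ n (iota_at k f) | k f. f \<in> I} = piQ n ` Jgens" by (auto simp: Jgens_def)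
  ultimately show ?thesis by (simp add: Jideal_def)
qed

lemma ideal_J: "ideal (Jideal n I) (Rring n)"
  unfolding Jideal_eq using Jgens_carrier piQ_surj by (intro ring.genideal_ideal R_ring) auto

lemma Jgens_J: "piQ n ` Jgens \<subseteq> Jideal n I"
  unfolding Jideal_eq using Jgens_carrier piQ_surj by (intro ring.genideal_self R_ring) auto

lemma S_ring: "ring (Sring n I)"
  unfolding Sring_def by (rule ideal.quotient_is_ring[OF ideal_J])

lemma piS_hom: "piS n I \<in> ring_hom (Rring n) (Sring n I)"
  unfolding piS_def Sring_def by (rule ideal.rcos_ring_hom[OF ideal_J])

lemma piS_surj: "piS n I ` carrier (Rring n) = carrier (Sring n I)"
  by (auto simp: piS_def Sring_def FactRing_def A_RCOSETS_defs a_r_coset_def)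

definition piPS :: "'k cpoly \<Rightarrow> 'k cpoly set set" where
  "piPS p = piS n I (piQ n p)"

lemma piPS_hom: "piPS \<in> ring_hom (Pring n) (Sring n I)"
  using ring_hom_trans[OF piQ_hom piS_hom] by (simp add: piPS_def[abs_def] comp_def)

lemma piPS_surj: "piPS ` carrier (Pring n) = carrier (Sring n I)"
  by (simp add: piPS_def[abs_def] piS_surj[symmetric] piQ_surj[symmetric] image_image)

lemma Jhat_iff:
  assumes "p \<in> carrier (Pring n)"
  shows "p \<in> Jhat \<longleftrightarrow> piQ n p \<in> Jideal n I"
proof -
  have c: "piQ n p \<in> carrier (Rring n)" using piQ_surj assms by blast
  have z: "\<zero>\<^bsub>Sring n I\<^esub> = Jideal n I" by (simp add: Sring_def FactRing_def)
  show ?thesis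
    using abelian_subgroup.a_rcos_self[OF abelian_subgroupI3 c, of "Jideal n I"] assms
      ring.a_rcos_zero[OF R_ring ideal_J, of "piQ n p"] ideal_J ideal.axioms(1)
      ring.is_abelian_group[OF R_ring]
    by (auto simp: Jhat_def piS_def z)
qed

lemma piPS_zero: "piPS 0 = \<zero>\<^bsub>Sring n I\<^esub>"
  using ring_hom_zero[OF piPS_hom P_ring S_ring] by simp

lemma piPS_closed: "p \<in> carrier (Pring n) \<Longrightarrow> piPS p \<in> carrier (Sring n I)"
  using piPS_surj by blast

lemma piPS_add: "p \<in> carrier (Pring n) \<Longrightarrow> q \<in> carrier (Pring n) \<Longrightarrow>
    piPS (p + q) = piPS p \<oplus>\<^bsub>Sring n I\<^esub> piPS q"
  using ring_hom_add[OF piPS_hom, of p q] by simp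

lemma piPS_mult: "p \<in> carrier (Pring n) \<Longrightarrow> q \<in> carrier (Pring n) \<Longrightarrow>
    piPS (p * q) = piPS p \<otimes>\<^bsub>Sring n I\<^esub> piPS q"
  using ring_hom_mult[OF piPS_hom, of p q] by simp

lemma ideal_Jhat: "ideal Jhat (Pring n)"
proof -
  interpret S: ring "Sring n I" by (rule S_ring)
  have "Jhat = {p \<in> carrier (Pring n). piPS p = \<zero>\<^bsub>Sring n I\<^esub>}"
    by (simp add: Jhat_def piPS_def)
  then show ?thesis
    by (intro P_ideal_criterion)
      (auto simp: P_add P_mult piPS_add piPS_mult piPS_zero piPS_closed, auto simp: carrier_P)
qed

text \<open>The image of \<open>X\<close> in \<open>R\<close> is an ideal containing the generators
  of \<open>J\<close>, and \<open>X\<close> is the full preimage of its image because it contains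
  \<open>Q\<close>. This serves as the induction principle for \<open>Jhat\<close>.\<close>

lemma Jhat_least:
  assumes X: "ideal X (Pring n)" "Qgens n \<subseteq> X" "Jgens \<subseteq> X"
  shows "Jhat \<subseteq> X"
proof -
  have "ideal (piQ n ` X) (Rring n)"
  proof (rule ring.ideal_criterion[OF R_ring])
    note XD = P_idealD[OF X(1)]
    show "piQ n ` X \<subseteq> carrier (Rring n)" using XD(1) piQ_surj by blast
    show "\<zero>\<^bsub>Rring n\<^esub> \<in> piQ n ` X"
      using XD(2) ring_hom_zero[OF piQ_hom P_ring R_ring] by force
    fix x y assume "x \<in> piQ n ` X" "y \<in> piQ n ` X"
    then obtain p q where "p \<in> X" "x = piQ n p" "q \<in> X" "y = piQ n q" by blast
    then show "x \<oplus>\<^bsub>Rring n\<^esub> y \<in> piQ n ` X"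
      using ring_hom_add[OF piQ_hom[of n], of p q] XD by (auto intro!: image_eqI[of _ _ "p + q"])
  next
    note XD = P_idealD[OF X(1)]
    fix x and a :: "'k cpoly set" assume "x \<in> piQ n ` X" "a \<in> carrier (Rring n)"
    then obtain p b where p: "p \<in> X" "x = piQ n p" and b: "b \<in> carrier (Pring n)" "a = piQ n b"
      unfolding piQ_surj[symmetric] by blast
    then show "a \<otimes>\<^bsub>Rring n\<^esub> x \<in> piQ n ` X"
      using ring_hom_mult[OF piQ_hom[of n], of b p] XD by (auto intro!: image_eqI[of _ _ "b * p"])
    show "x \<otimes>\<^bsub>Rring n\<^esub> a \<in> piQ n ` X"
      using ring_hom_mult[OF piQ_hom[of n], of p b] XD p b by (auto intro!: image_eqI[of _ _ "b * p"] simp: mult.commute[of p b])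
  qed
  then have "Jideal n I \<subseteq> piQ n ` X"
    unfolding Jideal_eq using X by (intro ring.genideal_minimal R_ring) auto
  show ?thesis
  proof
    fix p assume p: "p \<in> Jhat"
    then have pc: "p \<in> carrier (Pring n)" by (simp add: Jhat_def)
    then obtain x where x: "x \<in> X" "piQ n p = piQ n x"
      using \<open>Jideal n I \<subseteq> piQ n ` X\<close> Jhat_iff[OF pc] p by blast
    then have "p - x \<in> Qideal n" using piQ_eq_iff[OF pc, of x] P_idealD(1)[OF X(1)] by blast
    then have "p - x \<in> X" using Qideal_least[OF X(1,2)] by blast
    then show "p \<in> X" using P_idealD(3)[OF X(1) _ x(1), of "p - x"] by simp
  qed
qed

end

section \<open>Homogeneity and shift stability of the kernel\<close>

context letterplace
begin

lemma Qgens_Jhat: "Qgens n \<subseteq> Jhat"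
proof
  fix p :: "'k cpoly" assume p: "p \<in> Qgens n"
  then have pc: "p \<in> carrier (Pring n)" using Qgens_carrier by blast
  have "0 \<in> carrier (Pring n)" by (simp add: carrier_P)
  then have "piQ n p = piQ n 0" using piQ_eq_iff[OF pc, of 0] p Qgens_Q by auto
  then have "piPS p = \<zero>\<^bsub>Sring n I\<^esub>" using piPS_zero by (simp add: piPS_def)
  then show "p \<in> Jhat" using pc by (simp add: Jhat_def piPS_def)
qed

lemma Jgens_Jhat: "Jgens \<subseteq> Jhat"
  using Jhat_iff Jgens_carrier Jgens_J by blast

lemma iota_at_Jhat: "f \<in> I \<Longrightarrow> iota_at k f \<in> Jhat"
  using Jgens_Jhat by (auto simp: Jgens_def)

lemma piPS_eq_iff:
  assumes "p \<in> carrier (Pring n)" "q \<in> carrier (Pring n)"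
  shows "piPS p = piPS q \<longleftrightarrow> p - q \<in> Jhat"
proof -
  interpret S: ring "Sring n I" by (rule S_ring)
  have d: "p - q \<in> carrier (Pring n)" using assms by (rule P_diff)
  have e: "piPS p = piPS (p - q) \<oplus>\<^bsub>Sring n I\<^esub> piPS q" using piPS_add[OF d assms(2)] by simp
  show ?thesis
  proof
    assume "piPS p = piPS q"
    then have "piPS (p - q) \<oplus>\<^bsub>Sring n I\<^esub> piPS q = piPS q" using e by simp
    then have "piPS (p - q) = \<zero>\<^bsub>Sring n I\<^esub>" using piPS_closed d assms by simp
    then show "p - q \<in> Jhat" using d by (simp add: Jhat_def piPS_def)
  next
    assume "p - q \<in> Jhat"
    then show "piPS p = piPS q" using e assms piPS_closed by (simp add: Jhat_def piPS_def)
  qed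
qed

lemma trunc_Jhat:
  assumes "p \<in> Jhat"
  shows "trunc pdeg d p \<in> Jhat"
proof -
  let ?X = "{p \<in> carrier (Pring n). \<forall>d. trunc pdeg d p \<in> Jhat}"
  note JD = P_idealD[OF ideal_Jhat]
  have "ideal ?X (Pring n)"
  proof (rule P_ideal_criterion)
    show "0 \<in> ?X" using JD(2) by (simp add: carrier_P)
    fix p a assume p: "p \<in> ?X" and a: "a \<in> carrier (Pring n :: 'k cpoly ring)"
    have "trunc pdeg d (a * p) \<in> Jhat" for d
    proof (induction a rule: pm_induct)
      case (single m)
      then have m: "Poly_Mapping.single m (Poly_Mapping.lookup a m) \<in> carrier (Pring n)"
        using a by (auto simp: carrier_P)
      show ?case
        by (subst trunc_shift[where deg = pdeg and e = "pdeg m"])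
          (use p JD(2) JD(4)[OF _ m] in \<open>auto simp: distrib_left mult_single pdeg_add split: if_splits\<close>)
    qed (simp_all add: JD distrib_right trunc_add)
    then show "a * p \<in> ?X" using p a by (simp add: P_mult)
  qed (auto simp: P_add trunc_add JD)
  moreover have "Qgens n \<subseteq> ?X"
  proof
    fix p :: "'k cpoly" assume p: "p \<in> Qgens n"
    then obtain m where "p = Poly_Mapping.single m 1" by (auto simp: Qgens_def)
    then have "trunc pdeg d p \<in> Jhat" for d using p Qgens_Jhat JD(2) by (auto simp: trunc_single)
    then show "p \<in> ?X" using p Qgens_carrier by blast
  qed
  moreover have "Jgens \<subseteq> ?X"
    using Jgens_carrier by (auto simp: Jgens_def trunc_iota_at iota_at_Jhat trunc_I)
  ultimately show ?thesis using Jhat_least[of ?X] assms by blast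
qed

lemma sigmaP_Jhat:
  assumes "p \<in> Jhat"
  shows "sigmaP p \<in> Jhat"
proof -
  let ?X = "{p \<in> carrier (Pring n). sigmaP p \<in> Jhat}"
  note JD = P_idealD[OF ideal_Jhat]
  have "ideal ?X (Pring n)"
  proof (rule P_ideal_criterion)
    show "0 \<in> ?X" using JD(2) by (simp add: carrier_P sigmaP_push)
  qed (auto simp: P_add P_mult sigmaP_add sigmaP_mult sigmaP_carrier intro: JD(3,4))
  moreover have "Qgens n \<subseteq> ?X" using Qgens_carrier sigmaP_Qgens Qgens_Jhat by blast
  moreover have "Jgens \<subseteq> ?X"
    using Jgens_carrier by (auto simp: Jgens_def sigmaP_iota_at iota_at_Jhat)
  ultimately show ?thesis using Jhat_least[of ?X] assms by blast
qed

text \<open>Two choices are nested here, one of an element of \<open>R\<close> and one of a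
  polynomial. Stability of \<open>Jhat\<close> under \<open>\<sigma>\<close> settles the first,
  \<open>sigmaR_piQ\<close> the second.\<close>

lemma sigmaS_piPS:
  assumes p: "p \<in> carrier (Pring n)"
  shows "sigmaS n I (piPS p) = piPS (sigmaP p)"
proof -
  define x where "x = (SOME x. x \<in> piS n I (piQ n p))"
  have "piQ n p \<in> carrier (Rring n)" using piQ_surj p by blast
  from ideal.coset_choice[OF ideal_J this] have x: "x \<in> carrier (Rring n)" "piS n I x = piS n I (piQ n p)"
    by (auto simp: x_def piS_def)
  obtain q where q: "q \<in> carrier (Pring n)" "x = piQ n q"
    using x(1) unfolding piQ_surj[symmetric] by blast
  have "piPS q = piPS p" using x(2) by (simp add: piPS_def q(2))
  then have "sigmaP (q - p) \<in> Jhat" using piPS_eq_iff q(1) p sigmaP_Jhat by blast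
  then have "sigmaP q - sigmaP p \<in> Jhat"
    by (simp add: additive_diff[of sigmaP, OF sigmaP_add])
  then have "piPS (sigmaP q) = piPS (sigmaP p)"
    using piPS_eq_iff q(1) p sigmaP_carrier by blast
  then show ?thesis
    by (simp add: sigmaS_def piPS_def x_def[symmetric] q(2) sigmaR_piQ[OF q(1)])
qed

section \<open>The algebra A, its embeddings into S and their retractions\<close>

definition piA :: "'k ncpoly \<Rightarrow> 'k ncpoly set" where
  "piA f = I +>\<^bsub>Fring n\<^esub> f"

lemma piA_hom: "piA \<in> ring_hom (Fring n) (Aring n I)"
  unfolding piA_def[abs_def] Aring_def by (rule ideal.rcos_ring_hom[OF ideal_I])

lemma piA_surj: "piA ` carrier (Fring n) = carrier (Aring n I)"
  by (auto simp: piA_def Aring_def FactRing_def A_RCOSETS_defs a_r_coset_def)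

lemma A_ring: "ring (Aring n I)"
  unfolding Aring_def by (rule ideal.quotient_is_ring[OF ideal_I])

lemma F_minus: "f \<in> carrier (Fring n) \<Longrightarrow> g \<in> carrier (Fring n) \<Longrightarrow> f \<ominus>\<^bsub>Fring n\<^esub> g = f - g"
  for f g :: "'k ncpoly"
  using ring_F by (intro a_minus_eq_minus) (auto simp: F_uminus)

lemma piA_eq_iff:
  assumes "f \<in> carrier (Fring n)" "g \<in> carrier (Fring n)"
  shows "piA f = piA g \<longleftrightarrow> f - g \<in> I"
  using ring.quotient_eq_iff_same_a_r_cos[OF ring_F ideal_I assms] F_minus[OF assms]
  by (auto simp: piA_def)

lemma piA_add: "f \<in> carrier (Fring n) \<Longrightarrow> g \<in> carrier (Fring n) \<Longrightarrow>
    piA (f + g) = piA f \<oplus>\<^bsub>Aring n I\<^esub> piA g"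
  using ring_hom_add[OF piA_hom, of f g] by simp

lemma piA_mult: "f \<in> carrier (Fring n) \<Longrightarrow> g \<in> carrier (Fring n) \<Longrightarrow>
    piA (nc_mult f g) = piA f \<otimes>\<^bsub>Aring n I\<^esub> piA g"
  using ring_hom_mult[OF piA_hom, of f g] by simp

lemma iotaA_piA:
  assumes f: "f \<in> carrier (Fring n)"
  shows "iotaA n I (piA f) = piPS (iota_at 0 f)"
proof -
  define g where "g = (SOME g. g \<in> piA f)"
  have g: "g \<in> carrier (Fring n)" "piA g = piA f"
    using ideal.coset_choice[OF ideal_I f] by (auto simp: g_def piA_def)
  then have "iota_at 0 (g - f) \<in> Jhat" using piA_eq_iff f iota_at_Jhat by blast
  then have "iota_at 0 g - iota_at 0 f \<in> Jhat"
    by (simp add: additive_diff[of "iota_at 0", OF iota_at_add])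
  then have "piPS (iota_at 0 g) = piPS (iota_at 0 f)"
    using piPS_eq_iff iota_at_carrier f g(1) by blast
  then show ?thesis by (simp add: iotaA_def g_def[symmetric] piPS_def iotaP_eq)
qed

lemma sigmaS_pow_iotaA:
  assumes "f \<in> carrier (Fring n)"
  shows "(sigmaS n I ^^ k) (iotaA n I (piA f)) = piPS (iota_at k f)"
  by (induction k) (simp_all add: iotaA_piA sigmaS_piPS iota_at_carrier assms sigmaP_iota_at)

text \<open>A monomial times \<open>\<sigma>\<^sup>j \<iota> f\<close> is retracted to \<open>u f v\<close> when the places of the monomial fill up
  those of \<open>\<sigma>\<^sup>j \<iota> f\<close> to an interval, and to zero otherwise.\<close>

lemma rho_single_iota_at:
  assumes f: "f \<in> I" "homF e f" and m: "m \<in> MonP n"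
  shows "rho k (Poly_Mapping.single m c * iota_at j f) \<in> I"
proof (cases "e = 0")
  case True
  \<comment> \<open>An \<open>f\<close> of degree 0 is a scalar and occupies no place, so its shift
    may be adjusted to \<open>k\<close>.\<close>
  have "iota_at j f = iota_at k f"
  proof -
    have "f = Poly_Mapping.single [] (Poly_Mapping.lookup f [])"
      using f(2) True by (intro poly_mapping_eqI) (auto simp: homF_def Ball_def in_keys_iff lookup_single when_def)
    then show ?thesis by (metis iota_at_single mon_at.simps(1))
  qed
  then have "rho k (Poly_Mapping.single m c * iota_at j f) = nc_mult f (rho (k + e) (Poly_Mapping.single m c))"
    using rho_iota_at_mult[OF f(2), of k "Poly_Mapping.single m c"] by (simp add: mult.commute)
  then show ?thesis using I_D(5)[OF f(1) rho_carrier[OF P_single[OF m]]] by simp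
next
  case False
  show ?thesis
  proof (cases "\<exists>w u. length w = e \<and> mon_at j w + m = mon_at k u")
    case True
    \<comment> \<open>One word of length \<open>e\<close> suffices: the resulting factorization of
      \<open>m\<close> depends only on the places \<open>j + 1, ..., j + e\<close>, so it serves all
      terms of \<open>f\<close>.\<close>
    then obtain w u where w: "length w = e" "mon_at j w + m = mon_at k u" by blast
    then have "w \<noteq> []" using False by auto
    from mon_at_infix[OF w(2) this] obtain u1 u2 where
      j: "j = k + length u1" and mm: "m = mon_at k u1 + mon_at (j + e) u2" using w(1) by blast
    have u12: "set u1 \<subseteq> {1..n}" "set u2 \<subseteq> {1..n}"
      using m MonP_addD[of "mon_at k u1" "mon_at (j + e) u2" n] MonP_mon_at by (auto simp: mm)
    let ?u1 = "Poly_Mapping.single u1 c" and ?u2 = "Poly_Mapping.single u2 (1::'k)"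
    have h1: "homF (length u1) ?u1" by (simp add: homF_def)
    have h2: "homF (length u1 + e) (nc_mult ?u1 f)"
      using f(2) by (auto simp: homF_def elim!: keys_nc_mult split: if_splits)
    have "Poly_Mapping.single m c
      = Poly_Mapping.single (mon_at k u1) c * Poly_Mapping.single (mon_at (j + e) u2) 1"
      by (simp add: mm mult_single)
    then have "Poly_Mapping.single m c * iota_at j f
      = iota_at k ?u1 * iota_at (k + length u1) f * Poly_Mapping.single (mon_at (j + e) u2) 1"
      by (simp add: j mult_ac)
    also have "iota_at k ?u1 * iota_at (k + length u1) f = iota_at k (nc_mult ?u1 f)"
      using iota_at_mult[OF h1] by simp
    finally have "rho k (Poly_Mapping.single m c * iota_at j f) = nc_mult (nc_mult ?u1 f) ?u2"
      using rho_iota_at_mult[OF h2, of k] by (simp add: j add.assoc)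
    moreover have "?u1 \<in> carrier (Fring n)" "?u2 \<in> carrier (Fring n)" using u12 by (auto simp: carrier_F)
    ultimately show ?thesis using f(1) I_D(4,5) by simp
  next
    case none: False
    have "rho k (Poly_Mapping.single m c * iota_at j f) = 0"
    proof (induction f rule: pm_induct)
      case (single w)
      then have "mon_at j w + m \<noteq> mon_at k u" for u using f(2) none by (auto simp: homF_def)
      then show ?case by (simp add: mult_single rho_single_other add.commute[of m])
    qed (simp_all add: iota_at_add distrib_left rho_add)
    then show ?thesis using I_D(2) by simp
  qed
qed

lemma rho_Jhat:
  assumes "p \<in> Jhat"
  shows "rho k p \<in> I"
proof -
  \<comment> \<open>\<open>\<rho>\<close> is not multiplicative, so the preimage of \<open>I\<close>
    need not be an ideal. This is the largest ideal inside it; taking \<open>q = 1\<close> at the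
    end recovers the claim.\<close>
  let ?X = "{p \<in> carrier (Pring n). \<forall>q\<in>carrier (Pring n). rho k (q * p) \<in> I}"
  have "ideal ?X (Pring n)"
  proof (rule P_ideal_criterion)
    show "0 \<in> ?X" using I_D(2) by (simp add: carrier_P)
    fix p a assume p: "p \<in> ?X" and a: "a \<in> carrier (Pring n :: 'k cpoly ring)"
    have "rho k (q * (a * p)) \<in> I" if "q \<in> carrier (Pring n)" for q
      using p P_mult[OF that a] by (simp add: mult.assoc[symmetric])
    then show "a * p \<in> ?X" using p a by (simp add: P_mult)
  qed (auto simp: P_add distrib_left rho_add I_D)
  moreover have "Qgens n \<subseteq> ?X"
  proof
    fix p :: "'k cpoly" assume p: "p \<in> Qgens n"
    then obtain i l j where pp:
      "p = Poly_Mapping.single (Poly_Mapping.single (i, j) 1 + Poly_Mapping.single (l, j) 1) 1"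
      by (auto simp: Qgens_def)
    have "rho k (q * p) = 0" for q
    proof (induction q rule: pm_induct)
      case (single m)
      have "m + (Poly_Mapping.single (i, j) 1 + Poly_Mapping.single (l, j) 1) \<noteq> mon_at k w" for w
        using mon_at_no_collision[of k w m i j l] by metis
      then show ?case by (simp add: pp mult_single rho_single_other)
    qed (simp_all add: distrib_right rho_add)
    then show "p \<in> ?X" using p Qgens_carrier I_D(2) by auto
  qed
  moreover have "Jgens \<subseteq> ?X"
  proof
    fix p assume p: "p \<in> Jgens"
    then obtain j f where f: "f \<in> I" "p = iota_at j f" by (auto simp: Jgens_def)
    \<comment> \<open>Both factors are split, \<open>q\<close> into terms and \<open>f\<close> into
      homogeneous components, which stay in \<open>I\<close> by \<open>trunc_I\<close>.\<close>
    have "rho k (q * iota_at j f) \<in> I" if q: "q \<in> carrier (Pring n)" for q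
    proof (induction q rule: pm_induct)
      case (single m)
      then have m: "m \<in> MonP n" using q by (auto simp: carrier_P)
      show ?case
        by (induction f rule: trunc_induct[of _ length])
          (simp_all add: rho_single_iota_at[OF trunc_I[OF f(1)] homF_trunc m] I_D iota_at_add distrib_left rho_add)
    qed (simp_all add: I_D distrib_right rho_add)
    then show "p \<in> ?X" using p f(2) Jgens_carrier by auto
  qed
  ultimately have "p \<in> ?X" using Jhat_least[of ?X] assms by blast
  moreover have "1 \<in> carrier (Pring n :: 'k cpoly ring)" by (simp add: carrier_P MonP_zero)
  ultimately show ?thesis by (auto dest!: bspec[of _ _ 1])
qed

definition rhoS :: "nat \<Rightarrow> 'k cpoly set set \<Rightarrow> 'k ncpoly set" where
  "rhoS k s = piA (rho k (SOME p. p \<in> carrier (Pring n) \<and> piPS p = s))"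

text \<open>Well defined because \<open>\<rho>\<close> sends \<open>Jhat\<close> into
  \<open>I\<close>; at this point the retraction descends to the quotients and
  \<open>\<iota>\<close> becomes injective on \<open>A\<close>.\<close>

lemma rhoS_piPS:
  assumes p: "p \<in> carrier (Pring n)"
  shows "rhoS k (piPS p) = piA (rho k p)"
proof -
  define q where "q = (SOME q. q \<in> carrier (Pring n) \<and> piPS q = piPS p)"
  have q: "q \<in> carrier (Pring n)" "piPS q = piPS p"
    using someI[of "\<lambda>q. q \<in> carrier (Pring n) \<and> piPS q = piPS p" p] p by (auto simp: q_def)
  then have "rho k (q - p) \<in> I" using piPS_eq_iff p rho_Jhat by blast
  then have "rho k q - rho k p \<in> I"
    by (simp add: additive_diff[of "rho k", OF rho_add])
  then have "piA (rho k q) = piA (rho k p)" using piA_eq_iff rho_carrier q(1) p by blast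
  then show ?thesis by (simp add: rhoS_def q_def)
qed

section \<open>A and S as graded rings, and the shifted embedding between them\<close>

lemma presentation_A:
  "graded_presentation (Fring n) (Aring n I) piA {w. set w \<subseteq> {1..n}} length [] (homA n I)"
proof -
  interpret F: ring "Fring n :: 'k ncpoly ring" by (rule ring_F)
  interpret A: ring "Aring n I" by (rule A_ring)
  have z: "piA 0 = \<zero>\<^bsub>Aring n I\<^esub>" using ring_hom_zero[OF piA_hom ring_F A_ring] by simp
  have F0: "(0 :: 'k ncpoly) \<in> carrier (Fring n)" by (simp add: carrier_F)
  show ?thesis
  proof
    fix f d assume f: "f \<in> carrier (Fring n)" "piA f = \<zero>\<^bsub>Aring n I\<^esub>"
    then have "f \<in> I" using piA_eq_iff[OF f(1) F0] z by simp
    then have "trunc length d f \<in> I" by (rule trunc_I)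
    then show "piA (trunc length d f) = \<zero>\<^bsub>Aring n I\<^esub>"
      using piA_eq_iff[OF _ F0] I_D(1) z by auto
  next
    fix p q :: "'k ncpoly" and d e
    assume "\<forall>m\<in>Poly_Mapping.keys p. length m = d" "\<forall>m\<in>Poly_Mapping.keys q. length m = e"
    then show "\<forall>m\<in>Poly_Mapping.keys (p \<otimes>\<^bsub>Fring n\<^esub> q). length m = d + e"
      by (auto elim!: keys_nc_mult)
  next
    show "homA n I d x \<longleftrightarrow> (\<exists>p\<in>carrier (Fring n). (\<forall>m\<in>Poly_Mapping.keys p. length m = d) \<and> x = piA p)" for d x
      by (auto simp: homA_def homF_def piA_def)
  qed (simp_all add: piA_hom piA_surj, simp_all add: carrier_F)
qed

lemma presentation_S:
  "graded_presentation (Pring n) (Sring n I) piPS (MonP n) pdeg 0 (homS n I)"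
proof -
  interpret P: ring "Pring n :: 'k cpoly ring" by (rule P_ring)
  interpret S: ring "Sring n I" by (rule S_ring)
  show ?thesis
  proof
    fix p d assume p: "p \<in> carrier (Pring n)" "piPS p = \<zero>\<^bsub>Sring n I\<^esub>"
    then have "p \<in> Jhat" by (simp add: Jhat_def piPS_def)
    then have "trunc pdeg d p \<in> Jhat" by (rule trunc_Jhat)
    then show "piPS (trunc pdeg d p) = \<zero>\<^bsub>Sring n I\<^esub>" by (simp add: Jhat_def piPS_def)
  next
    fix p q :: "'k cpoly" and d e
    assume "\<forall>m\<in>Poly_Mapping.keys p. pdeg m = d" "\<forall>m\<in>Poly_Mapping.keys q. pdeg m = e"
    then show "\<forall>m\<in>Poly_Mapping.keys (p \<otimes>\<^bsub>Pring n\<^esub> q). pdeg m = d + e"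
      using keys_mult[of p q] by (fastforce simp: pdeg_add)
  next
    show "homS n I d x \<longleftrightarrow> (\<exists>p\<in>carrier (Pring n). (\<forall>m\<in>Poly_Mapping.keys p. pdeg m = d) \<and> x = piPS p)" for d x
      by (auto simp: homS_def homP_iff piPS_def)
  qed (simp_all add: piPS_hom piPS_surj pdeg_eq_zero mult_single, simp_all add: carrier_P MonP_zero)
qed

sublocale GA: graded_presentation "Fring n" "Aring n I" piA "{w. set w \<subseteq> {1..n}}" length "[]" "homA n I"
  by (rule presentation_A)

sublocale GS: graded_presentation "Pring n" "Sring n I" piPS "MonP n" pdeg 0 "homS n I"
  by (rule presentation_S)

sublocale SE: shifted_embedding "Aring n I" "homA n I" GA.comp "Sring n I" "homS n I" GS.comp
  "\<lambda>k a. (sigmaS n I ^^ k) (iotaA n I a)" rhoS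
proof
  fix a b k
  assume "a \<in> carrier (Aring n I)"
  then obtain f where f: "f \<in> carrier (Fring n)" "a = piA f" by (rule GA.pi_obtain)
  show "(sigmaS n I ^^ k) (iotaA n I a) \<in> carrier (Sring n I)"
    using f by (simp add: sigmaS_pow_iotaA piPS_closed iota_at_carrier)
  show "rhoS k ((sigmaS n I ^^ k) (iotaA n I a)) = a"
    using f by (simp add: sigmaS_pow_iotaA rhoS_piPS iota_at_carrier rho_iota_at)
  assume "b \<in> carrier (Aring n I)"
  then obtain g where g: "g \<in> carrier (Fring n)" "b = piA g" by (rule GA.pi_obtain)
  show "(sigmaS n I ^^ k) (iotaA n I (a \<oplus>\<^bsub>Aring n I\<^esub> b)) =
    (sigmaS n I ^^ k) (iotaA n I a) \<oplus>\<^bsub>Sring n I\<^esub> (sigmaS n I ^^ k) (iotaA n I b)"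
    using f g by (simp add: piA_add[symmetric] sigmaS_pow_iotaA F_add iota_at_add piPS_add iota_at_carrier)
next
  fix s t k
  assume "s \<in> carrier (Sring n I)"
  then obtain p where p: "p \<in> carrier (Pring n)" "s = piPS p" by (rule GS.pi_obtain)
  show "rhoS k s \<in> carrier (Aring n I)"
    using p by (simp add: rhoS_piPS GA.pi_closed rho_carrier)
  assume "t \<in> carrier (Sring n I)"
  then obtain q where q: "q \<in> carrier (Pring n)" "t = piPS q" by (rule GS.pi_obtain)
  show "rhoS k (s \<oplus>\<^bsub>Sring n I\<^esub> t) = rhoS k s \<oplus>\<^bsub>Aring n I\<^esub> rhoS k t"
    using p q by (simp add: piPS_add[symmetric] rhoS_piPS P_add rho_add piA_add rho_carrier)
next
  fix e a k
  assume "homA n I e a"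
  then obtain f where f: "f \<in> carrier (Fring n)" "\<forall>w\<in>Poly_Mapping.keys f. length w = e" "a = piA f"
    by (rule GA.H_obtain)
  then have h: "homF e f" by (simp add: homF_def)
  show "homS n I e ((sigmaS n I ^^ k) (iotaA n I a))"
    using f homF_iota_at[OF h, of k]
    by (simp add: sigmaS_pow_iotaA) (intro GS.pi_H iota_at_carrier, auto simp: homP_iff)
  {
    fix s assume "s \<in> carrier (Sring n I)"
    then obtain p where p: "p \<in> carrier (Pring n)" "s = piPS p" by (rule GS.pi_obtain)
    show "rhoS k ((sigmaS n I ^^ k) (iotaA n I a) \<otimes>\<^bsub>Sring n I\<^esub> s) = a \<otimes>\<^bsub>Aring n I\<^esub> rhoS (k + e) s"
      using f p by (simp add: sigmaS_pow_iotaA piPS_mult[symmetric] iota_at_carrier rhoS_piPS P_mult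
          rho_iota_at_mult[OF h] piA_mult rho_carrier)
  next
    fix b assume "b \<in> carrier (Aring n I)"
    then obtain g where g: "g \<in> carrier (Fring n)" "b = piA g" by (rule GA.pi_obtain)
    show "(sigmaS n I ^^ k) (iotaA n I (a \<otimes>\<^bsub>Aring n I\<^esub> b)) =
      (sigmaS n I ^^ k) (iotaA n I a) \<otimes>\<^bsub>Sring n I\<^esub> (sigmaS n I ^^ (k + e)) (iotaA n I b)"
      using f g by (simp add: sigmaS_pow_iotaA piA_mult[symmetric] F_mult iota_at_mult[OF h]
          piPS_mult iota_at_carrier)
  }
next
  fix e s k
  assume "homS n I e s"
  then obtain p where p: "p \<in> carrier (Pring n)" "\<forall>m\<in>Poly_Mapping.keys p. pdeg m = e" "s = piPS p"
    by (rule GS.H_obtain)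
  show "homA n I e (rhoS k s)"
    using p homP_rho[of e p k]
    by (simp add: rhoS_piPS) (intro GA.pi_H rho_carrier, auto simp: homP_iff homF_def)
qed

lemma iota_mod_eq: "iota_mod n I r \<delta> = SE.jm r \<delta>"
  by (rule ext) (simp add: iota_mod_def SE.jm_def)

lemma Lmod_eq: "Lmod n I r \<delta> M = submod_gen (Sring n I) r (SE.jm r \<delta> ` M)"
  by (simp add: Lmod_def iota_mod_eq)

end

theorem mainTheorem10:
  fixes n r :: nat and \<delta> :: "nat \<Rightarrow> nat"
    and I :: "'k::field ncpoly set"
    and M G :: "(nat \<Rightarrow> 'k ncpoly set) set"
  assumes I: "graded_ideal_F n I"
    and M: "is_graded_submodule (Aring n I) (homA n I) r \<delta> M"
    and G: "G \<subseteq> M" "\<forall>g\<in>G. is_homogeneous (Aring n I) (homA n I) r \<delta> g"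
  shows "(is_basis (Aring n I) (homA n I) r \<delta> M G \<longleftrightarrow>
            is_basis (Sring n I) (homS n I) r \<delta> (Lmod n I r \<delta> M) (iota_mod n I r \<delta> ` G))
       \<and> (is_min_basis (Aring n I) (homA n I) r \<delta> M G \<longleftrightarrow>
            is_min_basis (Sring n I) (homS n I) r \<delta> (Lmod n I r \<delta> M) (iota_mod n I r \<delta> ` G))
       \<and> (\<forall>d. bnum (Aring n I) (homA n I) r \<delta> M d =
               bnum (Sring n I) (homS n I) r \<delta> (Lmod n I r \<delta> M) d)"
proof -
  interpret letterplace n I using I by unfold_locales
  have G': "\<forall>g\<in>G. \<exists>d. fm_hom (Aring n I) (homA n I) r \<delta> d g"
    using G(2) by (simp add: is_homogeneous_def)
  show ?thesis
    unfolding Lmod_eq iota_mod_eq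
    using SE.basis_transfer[OF M G(1) G'] SE.min_basis_transfer[OF M G(1) G'] SE.bnum_transfer[OF M]
    by blast
qed

end
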